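(* Let $A \in \mathbb{R}^{n\times m}$ with $n \ge m$ and let $Z \in \mathbb{R}^{n\times p}$ be a full column rank matrix with $p \le \mathrm{rank}(A)$. For a given $k \in \{1,\dots,p\}$, set $\Omega_k = U_k^{T} Z \in \mathbb{R}^{k\times p}$ and $\underline{\Omega}_k = \underline{U}_k^{T} Z \in \mathbb{R}^{(n-k)\times p}$, and assume that $\Omega_k$ has full row rank (i.e. $\mathrm{rank}(\Omega_k)=k$). Let $\widehat{\Sigma}_k = (\Sigma_k^2-\sigma_{k+1}^2 I_k)^{1/2}\in\mathbb{R}^{k\times k}$, $T_k = \underline{\Omega}_k \Omega_k^{\dagger} \in \mathbb{R}^{(n-k)\times k}$ and $S_k = (I_{n-k} + T_k T_k^{T})^{-1/2} T_k \in \mathbb{R}^{(n-k)\times k}$. Then $$\|[I_n-\pi(Z)]A\|_2^2 - \|\underline{A}_k\|_2^2 \;\le\; \min\left\{ \|S_k\|_2^2\,\|\widehat{\Sigma}_k\|_2^2,\; \|T_k\widehat{\Sigma}_k\|_2^2 \right\}.$$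
   Context: $A = U\Sigma V^{T}$ is a singular value decomposition, with $U\in\mathbb{R}^{n\times n}$, $V\in\mathbb{R}^{m\times m}$ orthogonal and $\Sigma\in\mathbb{R}^{n\times m}$ diagonal with singular values $\sigma_1\ge\dots\ge\sigma_m\ge 0$; set $\sigma_{m+1}=0$. Partition $U=[U_k\ \ \underline{U}_k]$, $V=[V_k\ \ \underline{V}_k]$, $\Sigma=\mathrm{diag}(\Sigma_k,\underline{\Sigma}_k)$ with $U_k\in\mathbb{R}^{n\times k}$, $\underline{U}_k\in\mathbb{R}^{n\times(n-k)}$, $V_k\in\mathbb{R}^{m\times k}$, $\underline{V}_k\in\mathbb{R}^{m\times(m-k)}$, $\Sigma_k=\mathrm{diag}(\sigma_1,\dots,\sigma_k)\in\mathbb{R}^{k\times k}$, $\underline{\Sigma}_k\in\mathbb{R}^{(n-k)\times(m-k)}$. Set $A_k=U_k\Sigma_kV_k^{T}$ and $\underline{A}_k=\underline{U}_k\underline{\Sigma}_k\underline{V}_k^{T}$, so $A=A_k+\underline{A}_k$ (with $\underline{A}_k=0$ if $k=m$). $\pi(Z)=ZZ^{\dagger}$ is the orthogonal projection onto the range (column space) of $Z$, $M^{\dagger}$ denotes the Moore-Penrose inverse, $\|\cdot\|_2$ is the spectral norm, and $I_n$ is the identity of order $n$. *)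

theory Defs
  imports
    Complex_Main
    "Jordan_Normal_Form.DL_Rank"
    "Jordan_Normal_Form.Gauss_Jordan_Elimination"
begin

definition vec_norm2 :: "real vec \<Rightarrow> real" where
  "vec_norm2 x = sqrt (x \<bullet> x)"

text \<open>The supremum is over the closed unit ball, which is nonempty and bounded, so this is
  meaningful (and equal to 0) also for matrices without rows or without columns.\<close>
definition spec_norm :: "real mat \<Rightarrow> real" where
  "spec_norm A = (SUP x \<in> {x \<in> carrier_vec (dim_col A). vec_norm2 x \<le> 1}. vec_norm2 (A *\<^sub>v x))"

text \<open>The library predicate \<^term>\<open>orthogonal_mat\<close> only asks for pairwise orthogonal nonzero columns,
  without normalisation.\<close>
definition orthonormal_mat :: "nat \<Rightarrow> real mat \<Rightarrow> bool" where
  "orthonormal_mat n U \<longleftrightarrow>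
     U \<in> carrier_mat n n \<and> U\<^sup>T * U = 1\<^sub>m n \<and> U * U\<^sup>T = 1\<^sub>m n"

text \<open>\<^term>\<open>sing_val \<Sigma> i\<close> is \<open>\<sigma>\<^sub>i\<close>, numbered from 1 (the library indexes matrices from 0), for a
  matrix with at least as many rows as columns; past the last column it is 0.\<close>
definition sing_val :: "real mat \<Rightarrow> nat \<Rightarrow> real" where
  "sing_val \<Sigma> i = (if 1 \<le> i \<and> i \<le> dim_col \<Sigma> then \<Sigma> $$ (i - 1, i - 1) else 0)"

definition is_svd :: "nat \<Rightarrow> nat \<Rightarrow> real mat \<Rightarrow> real mat \<Rightarrow> real mat \<Rightarrow> real mat \<Rightarrow> bool" where
  "is_svd n m A U \<Sigma> V \<longleftrightarrow>
     orthonormal_mat n U \<and> orthonormal_mat m V \<and>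
     \<Sigma> \<in> carrier_mat n m \<and> diagonal_mat \<Sigma> \<and>
     (\<forall>i\<in>{1..m}. 0 \<le> sing_val \<Sigma> i) \<and>
     (\<forall>i\<in>{1..<m}. sing_val \<Sigma> (i + 1) \<le> sing_val \<Sigma> i) \<and>
     A = U * \<Sigma> * V\<^sup>T"

definition first_cols :: "nat \<Rightarrow> 'a mat \<Rightarrow> 'a mat" where
  "first_cols k M = mat_of_cols (dim_row M) (take k (cols M))"

definition remaining_cols :: "nat \<Rightarrow> 'a mat \<Rightarrow> 'a mat" where
  "remaining_cols k M = mat_of_cols (dim_row M) (drop k (cols M))"

definition trailing_block :: "nat \<Rightarrow> 'a mat \<Rightarrow> 'a mat" where
  "trailing_block k M = mat (dim_row M - k) (dim_col M - k) (\<lambda>(i, j). M $$ (k + i, k + j))"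

definition is_pseudo_inverse :: "real mat \<Rightarrow> real mat \<Rightarrow> bool" where
  "is_pseudo_inverse M X \<longleftrightarrow>
     X \<in> carrier_mat (dim_col M) (dim_row M) \<and>
     M * X * M = M \<and> X * M * X = X \<and> (M * X)\<^sup>T = M * X \<and> (X * M)\<^sup>T = X * M"

definition pseudo_inverse :: "real mat \<Rightarrow> real mat" where
  "pseudo_inverse M = (THE X. is_pseudo_inverse M X)"

definition range_proj :: "real mat \<Rightarrow> real mat" where
  "range_proj Z = Z * pseudo_inverse Z"

definition psd_mat :: "nat \<Rightarrow> real mat \<Rightarrow> bool" where
  "psd_mat n M \<longleftrightarrow>
     M \<in> carrier_mat n n \<and> M\<^sup>T = M \<and> (\<forall>x\<in>carrier_vec n. 0 \<le> x \<bullet> (M *\<^sub>v x))"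

text \<open>The unique positive semidefinite square root; meaningful for positive semidefinite arguments.\<close>
definition mat_sqrt :: "real mat \<Rightarrow> real mat" where
  "mat_sqrt M = (THE R. psd_mat (dim_row M) R \<and> R * R = M)"

end

theory Submission
  imports Defs "Jordan_Normal_Form.Spectral_Radius"
begin

text \<open>Let \<open>P = I - \<pi>(Z)\<close> and \<open>s = \<sigma>\<^bsub>k+1\<^esub>\<close>. Since \<open>\<Sigma>\<Sigma>\<^sup>T\<close> is dominated by
  \<open>s\<^sup>2 I + diag(\<Sigma>hat\<^sup>2, 0)\<close>, one gets \<open>\<parallel>P A\<parallel>\<^sup>2 \<le> s\<^sup>2 + \<parallel>P U\<^sub>k \<Sigma>hat\<parallel>\<^sup>2\<close>, while \<open>s \<le> \<parallel>A\<^sub>r\<parallel>\<close>.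
  The full row rank of \<open>\<Omega>\<^sub>k\<close> gives \<open>Z \<Omega>\<^sub>k\<^sup>\<dagger> = U\<^sub>k + U\<^sub>r T\<close>, which \<open>P\<close> annihilates, so
  \<open>\<parallel>P U\<^sub>k x\<parallel>\<^sup>2 \<le> \<parallel>x - c\<parallel>\<^sup>2 + \<parallel>T c\<parallel>\<^sup>2\<close> for every \<open>c\<close>. Taking \<open>c = x\<close> yields the bound by \<open>T\<close>;
  the minimiser \<open>c = x - T\<^sup>T y\<close> with \<open>(I + T T\<^sup>T) y = T x\<close> yields the bound by \<open>S\<close>.\<close>

section \<open>Euclidean and spectral norm\<close>

text \<open>The estimate of \<open>P A\<close> runs through its transpose, since
  \<open>(P A)\<^sup>T z = V \<Sigma>\<^sup>T U\<^sup>T P z\<close>: the isometry \<open>V\<close>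
  drops out, the domination of \<open>\<Sigma> \<Sigma>\<^sup>T\<close> acts on the coordinates of
  \<open>P z\<close> in the basis \<open>U\<close>, and the contraction \<open>P\<close> lets the
  scalar part cost no more than \<open>s\<^sup>2\<close>. Geometrically, the columns of
  \<open>U\<^sub>k + U\<^sub>r T\<close> span a subspace of the range of \<open>Z\<close> that is
  the graph of \<open>T\<close> over the range of \<open>U\<^sub>k\<close>. The singular values of
  \<open>T\<close> are the tangents of the angles between the two subspaces, and those of
  \<open>S\<close> are the corresponding sines. The pseudo-inverse and the square root are definite
  descriptions, which yield nothing before existence and uniqueness are known. Hence the rank
  hypotheses are converted into injectivity, which makes the Gram matrices invertible, and square
  roots are obtained from a spectral theorem for real symmetric matrices.\<close>

lemma scalar_prod_self_eq_sum:
  fixes x :: "real vec"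
  assumes "x \<in> carrier_vec n"
  shows "x \<bullet> x = (\<Sum>i<n. (x $ i)\<^sup>2)"
  using assms by (auto simp: scalar_prod_def power2_eq_square lessThan_atLeast0)

lemma scalar_prod_self_ge_0 [simp]: "0 \<le> (x :: real vec) \<bullet> x"
  by (simp add: scalar_prod_def sum_nonneg)

lemma scalar_prod_self_eq_0_iff:
  fixes x :: "real vec"
  assumes "x \<in> carrier_vec n"
  shows "x \<bullet> x = 0 \<longleftrightarrow> x = 0\<^sub>v n"
  using assms by (auto simp: scalar_prod_self_eq_sum sum_nonneg_eq_0_iff)

lemma vec_norm2_ge_0 [simp]: "0 \<le> vec_norm2 x"
  by (simp add: vec_norm2_def)

lemma power2_vec_norm2: "(vec_norm2 x)\<^sup>2 = x \<bullet> x"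
  by (simp add: vec_norm2_def)

lemma vec_norm2_smult: "vec_norm2 (a \<cdot>\<^sub>v x) = \<bar>a\<bar> * vec_norm2 x"
  by (simp add: vec_norm2_def real_sqrt_mult flip: mult.assoc)

lemma vec_norm2_eq_0_iff:
  assumes "x \<in> carrier_vec n"
  shows "vec_norm2 x = 0 \<longleftrightarrow> x = 0\<^sub>v n"
  using scalar_prod_self_eq_0_iff[OF assms] by (simp add: vec_norm2_def)

lemma vec_norm2_le_iff: "vec_norm2 x \<le> vec_norm2 y \<longleftrightarrow> x \<bullet> x \<le> y \<bullet> y"
  by (simp add: vec_norm2_def)

lemma scalar_prod_le_vec_norm2_mult:
  assumes x: "x \<in> carrier_vec n" and y: "y \<in> carrier_vec n"
  shows "x \<bullet> y \<le> vec_norm2 x * vec_norm2 y"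
proof (cases "y = 0\<^sub>v n")
  case True
  then show ?thesis using x by simp
next
  case False
  let ?X = "x \<bullet> x" and ?Y = "y \<bullet> y" and ?c = "x \<bullet> y"
  have Y: "?Y > 0" using False scalar_prod_self_eq_0_iff[OF y] scalar_prod_self_ge_0[of y] by linarith
  \<comment> \<open>Up to the factor \<open>?Y\<close> this vector is the component of
    \<open>x\<close> orthogonal to \<open>y\<close>; the scaling avoids a division.\<close>
  have "0 \<le> (?Y \<cdot>\<^sub>v x - ?c \<cdot>\<^sub>v y) \<bullet> (?Y \<cdot>\<^sub>v x - ?c \<cdot>\<^sub>v y)" by simp
  also have "\<dots> = ?Y * (?X * ?Y - ?c\<^sup>2)"
    using x y comm_scalar_prod[OF x y]
    by (simp add: minus_scalar_prod_distrib[of _ n] scalar_prod_minus_distrib[of _ n]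
        algebra_simps power2_eq_square)
  finally have "?c\<^sup>2 \<le> ?X * ?Y" using Y by (simp add: zero_le_mult_iff)
  then have "?c\<^sup>2 \<le> (vec_norm2 x * vec_norm2 y)\<^sup>2"
    by (simp add: power_mult_distrib power2_vec_norm2)
  then show ?thesis by (rule power2_le_imp_le) simp
qed

lemma scalar_prod_mult_mat_vec_self:
  fixes A :: "real mat"
  assumes A: "A \<in> carrier_mat nr nc" and x: "x \<in> carrier_vec nc"
  shows "(A *\<^sub>v x) \<bullet> (A *\<^sub>v x) = x \<bullet> ((A\<^sup>T * A) *\<^sub>v x)"
proof -
  have "(A *\<^sub>v x) \<bullet> (A *\<^sub>v x) = (A\<^sup>T *\<^sub>v (A *\<^sub>v x)) \<bullet> x"
    by (rule transpose_vec_mult_scalar[symmetric]) (use A x in auto)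
  also have "\<dots> = x \<bullet> ((A\<^sup>T * A) *\<^sub>v x)"
    using A x by (subst comm_scalar_prod[of _ nc]) (auto simp: assoc_mult_mat_vec[of _ nc nr])
  finally show ?thesis .
qed

text \<open>Cauchy-Schwarz on each row gives the Frobenius norm as constant. Any finite constant
  would serve: it makes the set in \<open>spec_norm\<close> bounded above, so that its supremum is a
  genuine one.\<close>

lemma mult_mat_vec_bounded:
  fixes A :: "real mat"
  obtains C where "0 \<le> C"
    "\<And>x. x \<in> carrier_vec (dim_col A) \<Longrightarrow> vec_norm2 (A *\<^sub>v x) \<le> C * vec_norm2 x"
proof
  let ?S = "\<Sum>i<dim_row A. (vec_norm2 (row A i))\<^sup>2"
  show "0 \<le> sqrt ?S" by (simp add: sum_nonneg)
  fix x :: "real vec" assume x: "x \<in> carrier_vec (dim_col A)"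
  have r: "(row A i \<bullet> x)\<^sup>2 \<le> (vec_norm2 (row A i))\<^sup>2 * (vec_norm2 x)\<^sup>2" for i
  proof -
    have c: "row A i \<in> carrier_vec (dim_col A)" by (simp add: row_def)
    have "row A i \<bullet> x \<le> vec_norm2 (row A i) * vec_norm2 x"
      using scalar_prod_le_vec_norm2_mult[OF c x] .
    \<comment> \<open>Cauchy-Schwarz was shown for the signed product only; the negated row supplies
      the other side, so that the inequality can be squared.\<close>
    moreover have "- (row A i \<bullet> x) \<le> vec_norm2 (row A i) * vec_norm2 x"
      using scalar_prod_le_vec_norm2_mult[of "-1 \<cdot>\<^sub>v row A i" "dim_col A" x] c x
      by (simp only: vec_norm2_smult) simp
    ultimately show ?thesis
      by (metis abs_le_iff abs_le_square_iff abs_of_nonneg mult_nonneg_nonneg power_mult_distrib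
          vec_norm2_ge_0)
  qed
  have y: "A *\<^sub>v x \<in> carrier_vec (dim_row A)" by (rule carrier_vecI) simp
  have "(A *\<^sub>v x) \<bullet> (A *\<^sub>v x) = (\<Sum>i<dim_row A. (row A i \<bullet> x)\<^sup>2)"
    unfolding scalar_prod_self_eq_sum[OF y] by (intro sum.cong) simp_all
  also have "\<dots> \<le> ?S * (vec_norm2 x)\<^sup>2"
    unfolding sum_distrib_right by (rule sum_mono) (rule r)
  finally have "sqrt ((A *\<^sub>v x) \<bullet> (A *\<^sub>v x)) \<le> sqrt (?S * (vec_norm2 x)\<^sup>2)" by simp
  then show "vec_norm2 (A *\<^sub>v x) \<le> sqrt ?S * vec_norm2 x"
    unfolding real_sqrt_mult by (simp add: vec_norm2_def)
qed

lemma bdd_above_vec_norm2_image: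
  "bdd_above ((\<lambda>x. vec_norm2 (A *\<^sub>v x)) ` {x \<in> carrier_vec (dim_col A). vec_norm2 x \<le> 1})"
proof -
  obtain C where C: "0 \<le> C"
    "\<And>x. x \<in> carrier_vec (dim_col A) \<Longrightarrow> vec_norm2 (A *\<^sub>v x) \<le> C * vec_norm2 x"
    using mult_mat_vec_bounded[of A] by blast
  show ?thesis
  proof (rule bdd_aboveI2)
    fix x assume "x \<in> {x \<in> carrier_vec (dim_col A). vec_norm2 x \<le> 1}"
    then show "vec_norm2 (A *\<^sub>v x) \<le> C"
      using C(2)[of x] mult_left_mono[OF _ C(1), of "vec_norm2 x" 1] by auto
  qed
qed

lemma spec_norm_ge_0 [simp]: "0 \<le> spec_norm A"
  unfolding spec_norm_def
  by (rule cSUP_upper2[OF bdd_above_vec_norm2_image, of "0\<^sub>v (dim_col A)"]) (auto simp: vec_norm2_def)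

lemma vec_norm2_mult_mat_vec_le:
  fixes A :: "real mat"
  assumes A: "A \<in> carrier_mat nr nc" and x: "x \<in> carrier_vec nc"
  shows "vec_norm2 (A *\<^sub>v x) \<le> spec_norm A * vec_norm2 x"
proof (cases "vec_norm2 x = 0")
  case True
  then have "x = 0\<^sub>v nc" using vec_norm2_eq_0_iff[OF x] by simp
  moreover have "A *\<^sub>v 0\<^sub>v nc = 0\<^sub>v nr" using A by (intro eq_vecI) auto
  ultimately show ?thesis by (simp add: vec_norm2_def)
next
  case False
  let ?a = "inverse (vec_norm2 x)"
  have pos: "vec_norm2 x > 0" using False vec_norm2_ge_0[of x] by linarith
  have "vec_norm2 (A *\<^sub>v (?a \<cdot>\<^sub>v x)) \<le> spec_norm A"
    unfolding spec_norm_def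
    by (rule cSUP_upper[OF _ bdd_above_vec_norm2_image]) (use A x False in \<open>auto simp: vec_norm2_smult\<close>)
  also have "A *\<^sub>v (?a \<cdot>\<^sub>v x) = ?a \<cdot>\<^sub>v (A *\<^sub>v x)" using A x by (rule mult_mat_vec)
  finally show ?thesis using pos by (simp add: vec_norm2_smult field_simps)
qed

lemma spec_norm_leI:
  fixes A :: "real mat"
  assumes A: "A \<in> carrier_mat nr nc" and "0 \<le> c"
    and le: "\<And>x. x \<in> carrier_vec nc \<Longrightarrow> vec_norm2 (A *\<^sub>v x) \<le> c * vec_norm2 x"
  shows "spec_norm A \<le> c"
  unfolding spec_norm_def
proof (rule cSUP_least)
  show "{x \<in> carrier_vec (dim_col A). vec_norm2 x \<le> 1} \<noteq> {}"
    by (auto intro!: exI[of _ "0\<^sub>v (dim_col A)"] simp: vec_norm2_def)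
  fix x assume "x \<in> {x \<in> carrier_vec (dim_col A). vec_norm2 x \<le> 1}"
  then show "vec_norm2 (A *\<^sub>v x) \<le> c"
    using A le[of x] mult_left_mono[OF _ \<open>0 \<le> c\<close>, of "vec_norm2 x" 1] by auto
qed

text \<open>Moving one factor \<open>A\<close> across the scalar product in
  \<open>(A x) \<bullet> (A x)\<close> and applying Cauchy-Schwarz leaves a common factor, the norm
  of \<open>A x\<close>, to cancel. Used for both \<open>A\<close> and its transpose, this gives
  equality of the norms.\<close>

lemma spec_norm_transpose_le:
  fixes A :: "real mat"
  assumes A: "A \<in> carrier_mat nr nc"
  shows "spec_norm A \<le> spec_norm A\<^sup>T"
proof (rule spec_norm_leI[OF A])
  fix x :: "real vec" assume x: "x \<in> carrier_vec nc"
  let ?y = "A *\<^sub>v x"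
  have y: "?y \<in> carrier_vec nr" using A x by auto
  have "(vec_norm2 ?y)\<^sup>2 = (A\<^sup>T *\<^sub>v ?y) \<bullet> x"
    unfolding power2_vec_norm2
    by (rule transpose_vec_mult_scalar[symmetric]) (use A x in auto)
  also have "\<dots> \<le> vec_norm2 (A\<^sup>T *\<^sub>v ?y) * vec_norm2 x"
    by (rule scalar_prod_le_vec_norm2_mult) (use A x in auto)
  also have "\<dots> \<le> (spec_norm A\<^sup>T * vec_norm2 ?y) * vec_norm2 x"
    by (rule mult_right_mono[OF vec_norm2_mult_mat_vec_le]) (use A y in auto)
  finally have "vec_norm2 ?y * vec_norm2 ?y \<le> vec_norm2 ?y * (spec_norm A\<^sup>T * vec_norm2 x)"
    by (simp add: power2_eq_square mult_ac)
  then show "vec_norm2 ?y \<le> spec_norm A\<^sup>T * vec_norm2 x"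
    using vec_norm2_ge_0[of ?y] by (cases "vec_norm2 ?y = 0") simp_all
qed simp

lemma spec_norm_transpose: "spec_norm A\<^sup>T = spec_norm A"
  using spec_norm_transpose_le[of A "dim_row A" "dim_col A"]
    spec_norm_transpose_le[of "A\<^sup>T" "dim_col A" "dim_row A"] by simp

section \<open>Spectral theorem for real symmetric matrices\<close>

lemma orthonormal_matD:
  assumes "orthonormal_mat n Q"
  shows "Q \<in> carrier_mat n n" "Q\<^sup>T * Q = 1\<^sub>m n" "Q * Q\<^sup>T = 1\<^sub>m n"
  using assms by (auto simp: orthonormal_mat_def)

lemma orthonormal_mat_mult:
  assumes P: "orthonormal_mat n P" and Q: "orthonormal_mat n Q"
  shows "orthonormal_mat n (P * Q)"
proof -
  note c = orthonormal_matD[OF P] orthonormal_matD[OF Q]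
  have "(P * Q)\<^sup>T * (P * Q) = Q\<^sup>T * ((P\<^sup>T * P) * Q)"
    using c(1,4) by (simp add: transpose_mult[of _ n n] assoc_mult_mat[of _ n n _ n _ n])
  moreover have "(P * Q) * (P * Q)\<^sup>T = P * ((Q * Q\<^sup>T) * P\<^sup>T)"
    using c(1,4) by (simp add: transpose_mult[of _ n n] assoc_mult_mat[of _ n n _ n _ n])
  ultimately show ?thesis using c by (simp add: orthonormal_mat_def)
qed

lemma orthonormal_mat_transpose:
  "orthonormal_mat n Q \<Longrightarrow> orthonormal_mat n Q\<^sup>T"
  by (simp add: orthonormal_mat_def)

lemma symmetric_scalar_prod_commute:
  fixes A :: "real mat"
  assumes A: "A \<in> carrier_mat n n" "A\<^sup>T = A" and x: "x \<in> carrier_vec n" and y: "y \<in> carrier_vec n"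
  shows "(A *\<^sub>v x) \<bullet> y = x \<bullet> (A *\<^sub>v y)"
  using transpose_vec_mult_scalar[OF A(1) y x] A(2) by simp

text \<open>Over the complex numbers an eigenvalue exists. Symmetry makes it real, and then the real
  and imaginary parts of the complex eigenvector both satisfy the eigenvalue equation; one of them
  is nonzero and can be normalised.\<close>

lemma symmetric_mat_unit_eigenvector:
  fixes A :: "real mat"
  assumes A: "A \<in> carrier_mat n n" "A\<^sup>T = A" and "n > 0"
  obtains v e where "v \<in> carrier_vec n" "v \<bullet> v = 1" "A *\<^sub>v v = e \<cdot>\<^sub>v v"
proof -
  note eigenvectorI = that
  let ?cA = "map_mat complex_of_real A"
  have cA: "?cA \<in> carrier_mat n n" using A by simp
  obtain l where "eigenvalue ?cA l"
    using spectrum_non_empty[OF cA \<open>n > 0\<close>] by (auto simp: spectrum_def)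
  then obtain z where z: "z \<in> carrier_vec n" "z \<noteq> 0\<^sub>v n" "?cA *\<^sub>v z = l \<cdot>\<^sub>v z"
    using A by (auto simp: eigenvalue_def eigenvector_def)
  define x where "x = map_vec Re z"
  define y where "y = map_vec Im z"
  have x: "x \<in> carrier_vec n" and y: "y \<in> carrier_vec n" using z by (auto simp: x_def y_def)
  have ent: "(\<Sum>j<n. complex_of_real (A $$ (i,j)) * z $ j) = l * z $ i" if "i < n" for i
    using arg_cong[OF z(3), of "\<lambda>v. v $ i"] that A(1) z(1)
    by (auto simp: scalar_prod_def lessThan_atLeast0)
  have Ax: "A *\<^sub>v x = Re l \<cdot>\<^sub>v x - Im l \<cdot>\<^sub>v y"
  proof (rule eq_vecI)
    fix i assume "i < dim_vec (Re l \<cdot>\<^sub>v x - Im l \<cdot>\<^sub>v y)"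
    then have i: "i < n" using x y by auto
    show "(A *\<^sub>v x) $ i = (Re l \<cdot>\<^sub>v x - Im l \<cdot>\<^sub>v y) $ i"
      using arg_cong[OF ent[OF i], of Re] i A(1) z(1)
      by (auto simp: scalar_prod_def lessThan_atLeast0 x_def y_def)
  qed (use A x y in auto)
  have Ay: "A *\<^sub>v y = Im l \<cdot>\<^sub>v x + Re l \<cdot>\<^sub>v y"
  proof (rule eq_vecI)
    fix i assume "i < dim_vec (Im l \<cdot>\<^sub>v x + Re l \<cdot>\<^sub>v y)"
    then have i: "i < n" using x y by auto
    show "(A *\<^sub>v y) $ i = (Im l \<cdot>\<^sub>v x + Re l \<cdot>\<^sub>v y) $ i"
      using arg_cong[OF ent[OF i], of Im] i A(1) z(1)
      by (auto simp: scalar_prod_def lessThan_atLeast0 x_def y_def)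
  qed (use A x y in auto)
  have nz: "x \<bullet> x + y \<bullet> y \<noteq> 0"
  proof
    assume "x \<bullet> x + y \<bullet> y = 0"
    then have "x \<bullet> x = 0" "y \<bullet> y = 0"
      using scalar_prod_self_ge_0[of x] scalar_prod_self_ge_0[of y] by linarith+
    then have "x = 0\<^sub>v n" "y = 0\<^sub>v n" using x y by (auto simp: scalar_prod_self_eq_0_iff)
    then have "Re (z $ i) = 0" "Im (z $ i) = 0" if "i < n" for i
      using that z(1) unfolding x_def y_def by (metis carrier_vecD index_map_vec(1) index_zero_vec(1))+
    then have "z = 0\<^sub>v n" using z(1) by (intro eq_vecI) (auto simp: complex_eq_iff)
    with z(2) show False by simp
  qed
  \<comment> \<open>After inserting \<open>Ax\<close> and \<open>Ay\<close>, the terms with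
    \<open>Re l\<close> cancel and only \<open>Im l\<close> times the squared length of the complex
    eigenvector remains.\<close>
  have "(A *\<^sub>v x) \<bullet> y = x \<bullet> (A *\<^sub>v y)" by (rule symmetric_scalar_prod_commute[OF A x y])
  then have "Im l * (x \<bullet> x + y \<bullet> y) = 0"
    using x y unfolding Ax Ay
    by (simp add: minus_scalar_prod_distrib[of _ n] scalar_prod_add_distrib[of _ n] algebra_simps)
  then have l0: "Im l = 0" using nz by simp
  have ev: thesis if w: "w \<in> carrier_vec n" "w \<bullet> w \<noteq> 0" "A *\<^sub>v w = Re l \<cdot>\<^sub>v w" for w
  proof (rule eigenvectorI)
    let ?a = "inverse (vec_norm2 w)"
    show "?a \<cdot>\<^sub>v w \<in> carrier_vec n" using w by simp
    have "vec_norm2 w * vec_norm2 w = w \<bullet> w" by (simp add: power2_vec_norm2[symmetric] power2_eq_square)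
    then show "(?a \<cdot>\<^sub>v w) \<bullet> (?a \<cdot>\<^sub>v w) = 1"
      using w(2) by (simp add: field_simps)
    show "A *\<^sub>v (?a \<cdot>\<^sub>v w) = Re l \<cdot>\<^sub>v (?a \<cdot>\<^sub>v w)"
      using mult_mat_vec[OF A(1) w(1)] w(1) unfolding w(3)
      by (simp add: smult_smult_assoc mult.commute)
  qed
  have "A *\<^sub>v x = Re l \<cdot>\<^sub>v x" "A *\<^sub>v y = Re l \<cdot>\<^sub>v y"
    unfolding Ax Ay l0 using x y by (auto intro!: eq_vecI)
  then show thesis using ev[OF x] ev[OF y] nz by fastforce
qed

section \<open>Householder reflections and diagonalization by deflation\<close>

definition householder :: "nat \<Rightarrow> real vec \<Rightarrow> real mat" where
  "householder n w = mat n n (\<lambda>(i, j). of_bool (i = j) - 2 / (w \<bullet> w) * (w $ i * w $ j))"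

lemma householder_carrier [simp]: "householder n w \<in> carrier_mat n n"
  by (simp add: householder_def)

lemma householder_transpose: "(householder n w)\<^sup>T = householder n w"
  by (auto simp: householder_def intro!: eq_matI)

lemma householder_mult_vec:
  assumes w: "w \<in> carrier_vec n" and x: "x \<in> carrier_vec n"
  shows "householder n w *\<^sub>v x = x - (2 / (w \<bullet> w) * (w \<bullet> x)) \<cdot>\<^sub>v w"
proof (rule eq_vecI)
  fix i assume "i < dim_vec (x - (2 / (w \<bullet> w) * (w \<bullet> x)) \<cdot>\<^sub>v w)"
  then have i: "i < n" using w by auto
  have "(householder n w *\<^sub>v x) $ i
      = (\<Sum>j\<in>{0..<n}. of_bool (i = j) * x $ j - 2 / (w \<bullet> w) * w $ i * (w $ j * x $ j))"
    using i x by (auto simp: householder_def scalar_prod_def algebra_simps intro!: sum.cong)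
  also have "\<dots> = x $ i - 2 / (w \<bullet> w) * w $ i * (w \<bullet> x)"
    using i x unfolding sum_subtractf sum_distrib_left[symmetric]
    by (simp add: scalar_prod_def[of w x])
  finally show "(householder n w *\<^sub>v x) $ i = (x - (2 / (w \<bullet> w) * (w \<bullet> x)) \<cdot>\<^sub>v w) $ i"
    using i w x by simp
qed (use w x in \<open>auto simp: householder_def\<close>)

lemma mat_eq_by_mult_vec:
  assumes A: "A \<in> carrier_mat nr nc" and B: "B \<in> carrier_mat nr nc"
    and eq: "\<And>x. x \<in> carrier_vec nc \<Longrightarrow> A *\<^sub>v x = B *\<^sub>v (x :: real vec)"
  shows "A = B"
proof (rule eq_matI)
  fix i j assume "i < dim_row B" "j < dim_col B"
  then show "A $$ (i, j) = B $$ (i, j)"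
    using arg_cong[OF eq[of "unit_vec nc j"], of "\<lambda>v. v $ i"] A B by auto
qed (use A B in auto)

text \<open>The reflection flips the sign of the component along \<open>w\<close>, so a second one
  adds back what the first removed. For \<open>w = 0\<close> the quotient \<open>2 / 0\<close> is 0
  and the matrix is the identity.\<close>

lemma householder_involution:
  assumes w: "w \<in> carrier_vec n"
  shows "householder n w * householder n w = 1\<^sub>m n"
proof (rule mat_eq_by_mult_vec)
  fix x :: "real vec" assume x: "x \<in> carrier_vec n"
  let ?a = "2 / (w \<bullet> w) * (w \<bullet> x)"
  have y: "x - ?a \<cdot>\<^sub>v w \<in> carrier_vec n" using w x by simp
  have "w \<bullet> (x - ?a \<cdot>\<^sub>v w) = - (w \<bullet> x)"
    using w x by (cases "w \<bullet> w = 0")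
      (auto simp: scalar_prod_minus_distrib[of _ n] scalar_prod_self_eq_0_iff)
  then have "householder n w *\<^sub>v (x - ?a \<cdot>\<^sub>v w) = (x - ?a \<cdot>\<^sub>v w) + ?a \<cdot>\<^sub>v w"
    unfolding householder_mult_vec[OF w y] using w x by (intro eq_vecI) auto
  then show "(householder n w * householder n w) *\<^sub>v x = 1\<^sub>m n *\<^sub>v x"
    using w x by (auto simp: assoc_mult_mat_vec[of _ n n _ n] householder_mult_vec[OF w x])
qed (auto intro!: mult_carrier_mat[of _ n n])

lemma orthonormal_mat_householder:
  "w \<in> carrier_vec n \<Longrightarrow> orthonormal_mat n (householder n w)"
  by (simp add: orthonormal_mat_def householder_transpose householder_involution)

text \<open>Two vectors of equal length are exchanged by the reflection along their difference. Here
  \<open>w \<bullet> w = 2 - 2 * v $ 0\<close> is minus twice \<open>w \<bullet> e\<close>, with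
  \<open>e\<close> the first unit vector, so the coefficient of \<open>w\<close> is -1. If
  \<open>v\<close> already equals \<open>e\<close>, the reflection degenerates to the
  identity.\<close>

lemma householder_unit_vec:
  assumes v: "v \<in> carrier_vec n" "v \<bullet> v = 1" and n: "0 < n"
  shows "householder n (v - unit_vec n 0) *\<^sub>v unit_vec n 0 = v"
proof -
  let ?w = "v - unit_vec n 0"
  have w: "?w \<in> carrier_vec n" using v by simp
  have ww: "?w \<bullet> ?w = 2 - 2 * v $ 0"
    using v n by (simp add: minus_scalar_prod_distrib[of _ n] scalar_prod_minus_distrib[of _ n])
  have we: "?w \<bullet> unit_vec n 0 = v $ 0 - 1"
    using v n by (simp add: minus_scalar_prod_distrib[of _ n])
  show ?thesis
  proof (cases "?w \<bullet> ?w = 0")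
    case True
    then have 0: "?w = 0\<^sub>v n" using scalar_prod_self_eq_0_iff[OF w] by simp
    have "v = unit_vec n 0"
    proof (rule eq_vecI)
      fix i assume "i < dim_vec (unit_vec n 0 :: real vec)"
      then show "v $ i = unit_vec n 0 $ i" using arg_cong[OF 0, of "\<lambda>u. u $ i"] v by simp
    qed (use v in auto)
    then show ?thesis
      using householder_mult_vec[OF w unit_vec_carrier, of 0] unfolding 0 by (auto intro!: eq_vecI)
  next
    case False
    then have "2 / (?w \<bullet> ?w) * (?w \<bullet> unit_vec n 0) = -1"
      unfolding we ww by (simp add: field_simps)
    then show ?thesis
      unfolding householder_mult_vec[OF w unit_vec_carrier] using v by (intro eq_vecI) auto
  qed
qed

text \<open>Deflation: a reflection moves a unit eigenvector to the first unit vector, after which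
  the first column is diagonal, by symmetry the first row too, and the induction hypothesis applies
  to the remaining block. A reflection is convenient because it is its own transpose and inverse, so
  the conjugate \<open>H * A * H\<close> is again symmetric.\<close>

lemma symmetric_mat_orthonormal_diagonalization:
  fixes A :: "real mat"
  assumes "A \<in> carrier_mat n n" "A\<^sup>T = A"
  obtains Q d where "orthonormal_mat n Q" "Q\<^sup>T * A * Q = mat_diag n d"
proof -
  have "\<exists>Q d. orthonormal_mat n Q \<and> Q\<^sup>T * A * Q = mat_diag n d"
    using assms
  proof (induction n arbitrary: A)
    case 0
    then show ?case by (intro exI[of _ "1\<^sub>m 0"] exI[of _ "\<lambda>_. 0"])
      (auto simp: orthonormal_mat_def mat_diag_def intro!: eq_matI)
  next
    case (Suc n)
    let ?N = "Suc n"
    obtain v e where v: "v \<in> carrier_vec ?N" "v \<bullet> v = 1" "A *\<^sub>v v = e \<cdot>\<^sub>v v"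
      using symmetric_mat_unit_eigenvector[OF Suc.prems] by blast
    define H where "H = householder ?N (v - unit_vec ?N 0)"
    have H: "orthonormal_mat ?N H" "H\<^sup>T = H" "H *\<^sub>v unit_vec ?N 0 = v"
      unfolding H_def using v(1)
      by (auto intro!: orthonormal_mat_householder householder_transpose householder_unit_vec v(2))
    note Hc = orthonormal_matD[OF H(1)]
    have HH: "H * H = 1\<^sub>m ?N" using Hc H(2) by simp
    have Hv: "H *\<^sub>v v = unit_vec ?N 0"
      using assoc_mult_mat_vec[OF Hc(1) Hc(1), of "unit_vec ?N 0"] HH H(3) by simp
    define A' where "A' = H * A * H"
    have A': "A' \<in> carrier_mat ?N ?N" using Hc Suc.prems by (simp add: A'_def)
    have A's: "A'\<^sup>T = A'"
      unfolding A'_def using Hc(1) Suc.prems H(2)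
      by (simp add: transpose_mult[of _ ?N ?N _ ?N] assoc_mult_mat[of _ ?N ?N _ ?N _ ?N])
    have A'e: "A' *\<^sub>v unit_vec ?N 0 = e \<cdot>\<^sub>v unit_vec ?N 0"
      unfolding A'_def using Hc(1) Suc.prems v
      by (simp add: assoc_mult_mat_vec[of _ ?N ?N _ ?N] H(3) Hv mult_mat_vec[of _ ?N ?N])
    have c0: "A' $$ (i, 0) = (if i = 0 then e else 0)" if "i < ?N" for i
      using arg_cong[OF A'e, of "\<lambda>u. u $ i"] that A' by auto
    have r0: "A' $$ (0, i) = (if i = 0 then e else 0)" if "i < ?N" for i
      using c0[OF that] A's A' that by (metis carrier_matD index_transpose_mat(1) zero_less_Suc)
    define B where "B = mat n n (\<lambda>(i, j). A' $$ (Suc i, Suc j))"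
    have B: "B \<in> carrier_mat n n" by (simp add: B_def)
    have Bs: "B\<^sup>T = B"
    proof (rule eq_matI)
      fix i j assume "i < dim_row B" "j < dim_col B"
      then have "A'\<^sup>T $$ (Suc i, Suc j) = A' $$ (Suc j, Suc i)" "i < n" "j < n"
        using A' by (auto simp: B_def)
      then show "B\<^sup>T $$ (i, j) = B $$ (i, j)" unfolding A's by (simp add: B_def)
    qed (auto simp: B_def)
    obtain P d where P: "orthonormal_mat n P" "P\<^sup>T * B * P = mat_diag n d"
      using Suc.IH[OF B Bs] by blast
    note Pc = orthonormal_matD[OF P(1)]
    \<comment> \<open>Matrices with a 1x1 corner and zero off-diagonal blocks multiply blockwise, so
      orthonormality and the diagonal form pass from \<open>P\<close> to
      \<open>blk 1 P\<close>.\<close>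
    define blk :: "real \<Rightarrow> real mat \<Rightarrow> real mat"
      where "blk a M = four_block_mat (mat 1 1 (\<lambda>_. a)) (0\<^sub>m 1 n) (0\<^sub>m n 1) M" for a M
    have mul: "blk a M * blk b M' = blk (a * b) (M * M')"
      if "M \<in> carrier_mat n n" "M' \<in> carrier_mat n n" for a b :: real and M M'
      unfolding blk_def using that
      by (subst mult_four_block_mat[of _ 1 1 _ n _ n _ _ 1 _ n])
        (auto intro!: arg_cong4[where f = four_block_mat] eq_matI simp: scalar_prod_def)
    have A'_blk: "A' = blk e B"
      by (rule eq_matI) (use A' c0 r0 in \<open>auto simp: B_def blk_def\<close>)
    let ?R = "blk 1 P"
    have Rc: "?R \<in> carrier_mat ?N ?N" using Pc by (auto simp: blk_def)
    have Rt: "?R\<^sup>T = blk 1 P\<^sup>T"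
      unfolding blk_def using Pc by (subst transpose_four_block_mat[of _ 1 1 _ n _ n]) auto
    have one: "blk 1 (1\<^sub>m n) = 1\<^sub>m ?N" unfolding blk_def by (rule eq_matI) auto
    have R: "orthonormal_mat ?N ?R"
      unfolding orthonormal_mat_def Rt using Rc Pc by (simp add: mul one)
    have "?R\<^sup>T * A' * ?R = blk e (mat_diag n d)"
      unfolding Rt A'_blk using Pc B P(2) by (simp add: mul)
    also have "\<dots> = mat_diag ?N (\<lambda>i. case i of 0 \<Rightarrow> e | Suc j \<Rightarrow> d j)"
      unfolding blk_def by (rule eq_matI) (auto simp: mat_diag_def split: nat.splits)
    finally have "(H * ?R)\<^sup>T * A * (H * ?R) = mat_diag ?N (\<lambda>i. case i of 0 \<Rightarrow> e | Suc j \<Rightarrow> d j)"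
      unfolding A'_def using Hc(1) Rc Suc.prems H(2)
      by (simp add: transpose_mult[of _ ?N ?N _ ?N] assoc_mult_mat[of _ ?N ?N _ ?N _ ?N])
    with orthonormal_mat_mult[OF H(1) R] show ?case by blast
  qed
  with that show thesis by blast
qed

section \<open>Pseudo-inverses\<close>

lemma is_pseudo_inverseD:
  assumes "is_pseudo_inverse M X" and "M \<in> carrier_mat nr nc"
  shows "X \<in> carrier_mat nc nr" "M * X * M = M" "X * M * X = X"
    "(M * X)\<^sup>T = M * X" "(X * M)\<^sup>T = X * M"
  using assms by (auto simp: is_pseudo_inverse_def)

text \<open>Both products are determined by \<open>M\<close>: inserting \<open>M = M * Y * M\<close>
  into \<open>M * X\<close> gives a product of two symmetric matrices, and transposing reverses them
  so that \<open>M * X * M\<close> collapses to \<open>M\<close>. The other product is handled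
  dually, and \<open>X = X * M * X\<close> then exchanges each factor for its counterpart with
  \<open>Y\<close>.\<close>

lemma is_pseudo_inverse_unique:
  assumes X: "is_pseudo_inverse M X" and Y: "is_pseudo_inverse M Y"
  shows "X = Y"
proof -
  obtain nr nc where M: "M \<in> carrier_mat nr nc" by blast
  note x = is_pseudo_inverseD[OF X M] and y = is_pseudo_inverseD[OF Y M]
  note c = M x(1) y(1)
  have "M * X = (M * Y * M) * X" by (simp only: y)
  also have "\<dots> = (M * Y) * (M * X)"
    by (rule assoc_mult_mat) (use c in auto)
  also have "\<dots> = (M * Y)\<^sup>T * (M * X)\<^sup>T" by (simp only: x y)
  also have "\<dots> = ((M * X) * (M * Y))\<^sup>T"
    by (rule transpose_mult[symmetric]) (use c in auto)
  also have "(M * X) * (M * Y) = M * X * M * Y"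
    by (rule assoc_mult_mat[symmetric]) (use c in auto)
  finally have MX: "M * X = M * Y" by (simp only: x y)
  have "X * M = X * (M * Y * M)" by (simp only: y)
  also have "M * Y * M = M * (Y * M)"
    by (rule assoc_mult_mat) (use c in auto)
  also have "X * (M * (Y * M)) = (X * M) * (Y * M)"
    by (rule assoc_mult_mat[symmetric]) (use c in auto)
  also have "\<dots> = (X * M)\<^sup>T * (Y * M)\<^sup>T" by (simp only: x y)
  also have "\<dots> = ((Y * M) * (X * M))\<^sup>T"
    by (rule transpose_mult[symmetric]) (use c in auto)
  also have "(Y * M) * (X * M) = Y * (M * (X * M))"
    by (rule assoc_mult_mat) (use c in auto)
  also have "M * (X * M) = M * X * M"
    by (rule assoc_mult_mat[symmetric]) (use c in auto)
  finally have XM: "X * M = Y * M" by (simp only: x y)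
  have "X = X * M * X" by (simp only: x)
  also have "\<dots> = Y * (M * X)" unfolding XM
    by (rule assoc_mult_mat) (use c in auto)
  also have "\<dots> = Y * M * Y" unfolding MX
    by (rule assoc_mult_mat[symmetric]) (use c in auto)
  finally show ?thesis by (simp only: y)
qed

lemma pseudo_inverse_eqI: "is_pseudo_inverse M X \<Longrightarrow> pseudo_inverse M = X"
  unfolding pseudo_inverse_def using is_pseudo_inverse_unique by blast

text \<open>The four conditions are self-dual. This reduces the case of full column rank, needed for
  \<open>Z\<close>, to the case of full row rank.\<close>

lemma is_pseudo_inverse_transpose:
  assumes "is_pseudo_inverse M X"
  shows "is_pseudo_inverse M\<^sup>T X\<^sup>T"
proof -
  obtain nr nc where M: "M \<in> carrier_mat nr nc" by blast
  note x = is_pseudo_inverseD[OF assms M]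
  note c = M x(1)
  have 1: "M\<^sup>T * X\<^sup>T = X * M"
    using transpose_mult[OF c(2,1)] x(5) by simp
  have 2: "X\<^sup>T * M\<^sup>T = M * X"
    using transpose_mult[OF c] x(4) by simp
  have "X * M * M\<^sup>T = (M * (X * M))\<^sup>T"
    using transpose_mult[of M nr nc "X * M" nc] c x(5) by simp
  also have "M * (X * M) = M"
    using x(2) assoc_mult_mat[OF c(1,2,1)] by simp
  finally have 3: "X * M * M\<^sup>T = M\<^sup>T" .
  have "M * X * X\<^sup>T = (X * (M * X))\<^sup>T"
    using transpose_mult[of X nc nr "M * X" nr] c x(4) by simp
  also have "X * (M * X) = X"
    using x(3) assoc_mult_mat[OF c(2,1,2)] by simp
  finally have 4: "M * X * X\<^sup>T = X\<^sup>T" .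
  show ?thesis unfolding is_pseudo_inverse_def 1 2 3 4
    using x(4,5) c by simp
qed

text \<open>A vanishing determinant would provide a nonzero kernel vector. The result is phrased
  through \<open>mat_inverse\<close>, so that the value selected by \<open>the\<close> in the
  definition of \<open>S\<^sub>k\<close> is known to be an inverse.\<close>

lemma inverse_mat_exists:
  fixes M :: "'a :: field mat"
  assumes M: "M \<in> carrier_mat n n"
    and inj: "\<And>x. x \<in> carrier_vec n \<Longrightarrow> M *\<^sub>v x = 0\<^sub>v n \<Longrightarrow> x = 0\<^sub>v n"
  obtains B where "mat_inverse M = Some B" "B \<in> carrier_mat n n" "M * B = 1\<^sub>m n" "B * M = 1\<^sub>m n"
proof -
  have "det M \<noteq> 0" using det_0_iff_vec_prod_zero_field[OF M] inj by blast
  then have "M \<in> Units (ring_mat TYPE('a) n ())" by (rule det_non_zero_imp_unit[OF M])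
  then have "mat_inverse M \<noteq> None" using mat_inverse(1)[OF M, where b = "()"] by blast
  then obtain B where B: "mat_inverse M = Some B" by blast
  with mat_inverse(2)[OF M B] that show thesis by blast
qed

text \<open>Injectivity of the transpose passes to \<open>M * M\<^sup>T\<close>, whose quadratic
  form at \<open>x\<close> is the squared norm of \<open>M\<^sup>T x\<close>. With \<open>B\<close>
  the inverse of this matrix, \<open>M\<^sup>T * B\<close> satisfies all four conditions and is
  visibly a right inverse.\<close>

lemma pseudo_inverse_right_inverse:
  assumes M: "M \<in> carrier_mat nr nc"
    and inj: "\<And>x. x \<in> carrier_vec nr \<Longrightarrow> M\<^sup>T *\<^sub>v x = 0\<^sub>v nc \<Longrightarrow> x = 0\<^sub>v nr"
  shows "is_pseudo_inverse M (pseudo_inverse M)" "M * pseudo_inverse M = 1\<^sub>m nr"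
proof -
  have MM: "M * M\<^sup>T \<in> carrier_mat nr nr" using M by simp
  have "x = 0\<^sub>v nr" if x: "x \<in> carrier_vec nr" "(M * M\<^sup>T) *\<^sub>v x = 0\<^sub>v nr" for x
  proof -
    have "(M\<^sup>T *\<^sub>v x) \<bullet> (M\<^sup>T *\<^sub>v x) = 0"
      using scalar_prod_mult_mat_vec_self[of "M\<^sup>T" nc nr x] M x by simp
    then show ?thesis using inj[OF x(1)] scalar_prod_self_eq_0_iff[of "M\<^sup>T *\<^sub>v x" nc] M x by auto
  qed
  then obtain B where B: "B \<in> carrier_mat nr nr" "M * M\<^sup>T * B = 1\<^sub>m nr" "B * (M * M\<^sup>T) = 1\<^sub>m nr"
    using inverse_mat_exists[OF MM] by metis
  have MMs: "(M * M\<^sup>T)\<^sup>T = M * M\<^sup>T" using M by (simp add: transpose_mult[of _ nr nc])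
  \<comment> \<open>An inverse of a symmetric matrix is symmetric; this is what makes
    \<open>M\<^sup>T * B * M\<close> symmetric.\<close>
  have "B\<^sup>T = B * (M * M\<^sup>T) * B\<^sup>T" using B by simp
  also have "\<dots> = B * ((M * M\<^sup>T) * B\<^sup>T)"
    by (rule assoc_mult_mat) (use B MM in auto)
  also have "(M * M\<^sup>T) * B\<^sup>T = (B * (M * M\<^sup>T))\<^sup>T"
    using transpose_mult[OF B(1) MM] MMs by simp
  finally have Bs: "B\<^sup>T = B" using B by simp
  let ?X = "M\<^sup>T * B"
  have X: "?X \<in> carrier_mat nc nr" using M B by simp
  have MX: "M * ?X = 1\<^sub>m nr"
    using assoc_mult_mat[of M nr nc "M\<^sup>T" nr B nr] M B by simp
  have "(?X * M)\<^sup>T = M\<^sup>T * ?X\<^sup>T" by (rule transpose_mult[OF X M])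
  also have "?X\<^sup>T = B * M"
    using transpose_mult[of "M\<^sup>T" nc nr B nr] M B Bs by simp
  also have "M\<^sup>T * (B * M) = ?X * M"
    by (rule assoc_mult_mat[symmetric]) (use M B in auto)
  finally have XMs: "(?X * M)\<^sup>T = ?X * M" .
  have XMX: "?X * M * ?X = ?X"
    by (simp only: assoc_mult_mat[OF X M X] MX right_mult_one_mat[OF X])
  have *: "is_pseudo_inverse M ?X"
    unfolding is_pseudo_inverse_def XMX XMs MX using M X by simp
  then show "is_pseudo_inverse M (pseudo_inverse M)" "M * pseudo_inverse M = 1\<^sub>m nr"
    using MX pseudo_inverse_eqI by metis+
qed

lemma is_pseudo_inverse_pseudo_inverse_injective:
  assumes M: "M \<in> carrier_mat nr nc"
    and inj: "\<And>x. x \<in> carrier_vec nc \<Longrightarrow> M *\<^sub>v x = 0\<^sub>v nr \<Longrightarrow> x = 0\<^sub>v nc"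
  shows "is_pseudo_inverse M (pseudo_inverse M)"
proof -
  have "is_pseudo_inverse M\<^sup>T (pseudo_inverse M\<^sup>T)"
    by (rule pseudo_inverse_right_inverse(1)[of _ nc nr]) (use M inj in auto)
  then have "is_pseudo_inverse M (pseudo_inverse M\<^sup>T)\<^sup>T"
    using is_pseudo_inverse_transpose by fastforce
  then show ?thesis using pseudo_inverse_eqI by metis
qed

section \<open>Positive semidefinite square roots\<close>

lemma psd_matD:
  assumes "psd_mat n M"
  shows "M \<in> carrier_mat n n" "M\<^sup>T = M" "\<And>x. x \<in> carrier_vec n \<Longrightarrow> 0 \<le> x \<bullet> (M *\<^sub>v x)"
  using assms by (auto simp: psd_mat_def)

lemma mat_diag_mult_vec:
  fixes x :: "real vec"
  assumes "x \<in> carrier_vec n"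
  shows "mat_diag n d *\<^sub>v x = vec n (\<lambda>i. d i * x $ i)"
proof (rule eq_vecI)
  fix i assume "i < dim_vec (vec n (\<lambda>i. d i * x $ i))"
  then have i: "i < n" by simp
  have "(if i = j then d j else 0) * x $ j = (if i = j then d i * x $ i else 0)" for j by simp
  then show "(mat_diag n d *\<^sub>v x) $ i = vec n (\<lambda>i. d i * x $ i) $ i"
    using i assms by (simp add: mat_diag_def scalar_prod_def)
qed (simp add: mat_diag_def)

lemma mat_diag_transpose: "(mat_diag n d)\<^sup>T = mat_diag n d"
  by (auto simp: mat_diag_def intro!: eq_matI)

lemma psd_mat_diag:
  assumes "\<And>i. i < n \<Longrightarrow> 0 \<le> d i"
  shows "psd_mat n (mat_diag n d)"
  unfolding psd_mat_def mat_diag_transpose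
proof (intro conjI ballI)
  fix x :: "real vec" assume x: "x \<in> carrier_vec n"
  have "0 \<le> x $ i * (d i * x $ i)" if "i < n" for i
    using mult_nonneg_nonneg[OF assms[OF that] zero_le_square[of "x $ i"]] by (simp add: mult_ac)
  then show "0 \<le> x \<bullet> (mat_diag n d *\<^sub>v x)"
    unfolding mat_diag_mult_vec[OF x] by (auto simp: scalar_prod_def intro!: sum_nonneg)
qed auto

lemma orthonormal_conjugate_eq:
  assumes Q: "orthonormal_mat n Q" and M: "M \<in> carrier_mat n n"
  shows "Q * (Q\<^sup>T * M * Q) * Q\<^sup>T = M"
proof -
  note q = orthonormal_matD[OF Q]
  have "Q * (Q\<^sup>T * M * Q) * Q\<^sup>T = (Q * Q\<^sup>T) * M * (Q * Q\<^sup>T)"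
    using q(1) M by (simp add: assoc_mult_mat[of _ n n _ n _ n])
  then show ?thesis using q M by simp
qed

text \<open>If \<open>R\<^sup>2 = S\<^sup>2\<close> and \<open>(R - S) v = d v\<close>, then \<open>d (v \<bullet> R v + v \<bullet> S v) = 0\<close>; when both quadratic
  forms are nonnegative this forces \<open>d = 0\<close>, so the symmetric matrix \<open>R - S\<close> vanishes.\<close>

lemma psd_sqrt_unique:
  assumes R: "psd_mat n R" and S: "psd_mat n S" and eq: "R * R = S * S"
  shows "R = S"
proof -
  note r = psd_matD[OF R] and s = psd_matD[OF S]
  let ?D = "R - S"
  have D: "?D \<in> carrier_mat n n" "?D\<^sup>T = ?D"
    using r s by (auto simp: transpose_minus[of _ n n])
  obtain Q d where Q: "orthonormal_mat n Q" "Q\<^sup>T * ?D * Q = mat_diag n d"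
    using symmetric_mat_orthonormal_diagonalization[OF D] by blast
  note q = orthonormal_matD[OF Q(1)]
  have "d j = 0" if j: "j < n" for j
  proof -
    define v where "v = Q *\<^sub>v unit_vec n j"
    have v: "v \<in> carrier_vec n" unfolding v_def using q by simp
    have e: "(unit_vec n j :: real vec) \<in> carrier_vec n" by simp
    have Qv: "Q\<^sup>T *\<^sub>v v = unit_vec n j"
      unfolding v_def using assoc_mult_mat_vec[of "Q\<^sup>T" n n Q n "unit_vec n j"] q by simp
    have vv: "v \<bullet> v = 1"
      using transpose_vec_mult_scalar[OF q(1) e v] j Qv by (simp add: v_def)
    have "?D *\<^sub>v v = (Q * mat_diag n d * Q\<^sup>T) *\<^sub>v v"
      unfolding Q(2)[symmetric] orthonormal_conjugate_eq[OF Q(1) D(1)] ..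
    also have "\<dots> = Q *\<^sub>v (mat_diag n d *\<^sub>v (Q\<^sup>T *\<^sub>v v))"
      using q(1) v by (simp add: assoc_mult_mat_vec[of _ n n _ n] del: assoc_mult_mat)
    also have "mat_diag n d *\<^sub>v (Q\<^sup>T *\<^sub>v v) = d j \<cdot>\<^sub>v unit_vec n j"
      unfolding Qv mat_diag_mult_vec[OF e] using j by (intro eq_vecI) (auto simp: unit_vec_def)
    also have "Q *\<^sub>v (d j \<cdot>\<^sub>v unit_vec n j) = d j \<cdot>\<^sub>v v"
      unfolding v_def using q(1) by (simp add: mult_mat_vec[of _ n n])
    finally have diff: "R *\<^sub>v v - S *\<^sub>v v = d j \<cdot>\<^sub>v v"
      using minus_mult_distrib_mat_vec[OF r(1) s(1) v] by simp
    have Rv: "R *\<^sub>v v = S *\<^sub>v v + d j \<cdot>\<^sub>v v"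
    proof (rule eq_vecI)
      fix i assume "i < dim_vec (S *\<^sub>v v + d j \<cdot>\<^sub>v v)"
      then show "(R *\<^sub>v v) $ i = (S *\<^sub>v v + d j \<cdot>\<^sub>v v) $ i"
        using arg_cong[OF diff, of "\<lambda>u. u $ i"] r(1) s(1) v by auto
    qed (use r(1) v in auto)
    have "(R *\<^sub>v v) \<bullet> (R *\<^sub>v v) = (S *\<^sub>v v) \<bullet> (S *\<^sub>v v)"
      using scalar_prod_mult_mat_vec_self[OF r(1) v] scalar_prod_mult_mat_vec_self[OF s(1) v]
      by (simp only: r(2) s(2) eq)
    moreover have Sv: "S *\<^sub>v v \<in> carrier_vec n" using s(1) v by simp
    ultimately have "d j * (2 * (v \<bullet> (S *\<^sub>v v)) + d j) = 0"
      unfolding Rv using v vv comm_scalar_prod[OF v Sv]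
      by (simp add: add_scalar_prod_distrib[of _ n] scalar_prod_add_distrib[of _ n] algebra_simps)
    moreover have "v \<bullet> (R *\<^sub>v v) = v \<bullet> (S *\<^sub>v v) + d j"
      unfolding Rv using v vv Sv by (simp add: scalar_prod_add_distrib[of _ n])
    \<comment> \<open>Were \<open>d j\<close> nonzero, the two nonnegative values of the quadratic
      forms would add up to zero, hence both vanish, and yet differ by \<open>d j\<close>.\<close>
    ultimately show ?thesis using r(3)[OF v] s(3)[OF v] by auto
  qed
  then have "mat_diag n d = 0\<^sub>m n n" by (auto simp: mat_diag_def intro!: eq_matI)
  then have "?D = 0\<^sub>m n n"
    using orthonormal_conjugate_eq[OF Q(1) D(1)] Q(2) q(1) by simp
  show ?thesis
  proof (rule eq_matI)
    fix i j assume "i < dim_row S" "j < dim_col S"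
    then show "R $$ (i, j) = S $$ (i, j)"
      using arg_cong[OF \<open>?D = 0\<^sub>m n n\<close>, of "\<lambda>M. M $$ (i, j)"] r(1) s(1) by auto
  qed (use r s in auto)
qed

lemma mat_sqrt_eqI:
  assumes "psd_mat n R" "R * R = M"
  shows "mat_sqrt M = R"
proof -
  have "dim_row M = n" using assms psd_matD(1)[OF assms(1)] by auto
  then show ?thesis
    unfolding mat_sqrt_def using assms psd_sqrt_unique by (intro the_equality) auto
qed

text \<open>In an orthonormal eigenbasis one takes roots of the eigenvalues; uniqueness then
  identifies this matrix with the described one.\<close>

lemma psd_mat_mat_sqrt:
  assumes M: "psd_mat n M"
  shows "psd_mat n (mat_sqrt M)" "mat_sqrt M * mat_sqrt M = M"
proof -
  note m = psd_matD[OF M]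
  obtain Q d where Q: "orthonormal_mat n Q" "Q\<^sup>T * M * Q = mat_diag n d"
    using symmetric_mat_orthonormal_diagonalization[OF m(1,2)] by blast
  note q = orthonormal_matD[OF Q(1)]
  \<comment> \<open>The eigenvalue \<open>d i\<close> is the value of the quadratic form of
    \<open>M\<close> at column \<open>i\<close> of \<open>Q\<close>.\<close>
  have d: "0 \<le> d i" if i: "i < n" for i
  proof -
    let ?e = "unit_vec n i :: real vec"
    have e: "?e \<in> carrier_vec n" by simp
    have "mat_diag n d *\<^sub>v ?e = Q\<^sup>T *\<^sub>v (M *\<^sub>v (Q *\<^sub>v ?e))"
      unfolding Q(2)[symmetric] using q(1) m(1)
      by (simp add: assoc_mult_mat_vec[of _ n n _ n] del: assoc_mult_mat)
    then have "?e \<bullet> (mat_diag n d *\<^sub>v ?e) = (Q *\<^sub>v ?e) \<bullet> (M *\<^sub>v (Q *\<^sub>v ?e))"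
      using transpose_vec_mult_scalar[of "Q\<^sup>T" n n "M *\<^sub>v (Q *\<^sub>v ?e)" ?e] q(1) m(1) by simp
    also have "\<dots> \<ge> 0" by (rule m(3)) (use q(1) in simp)
    finally show ?thesis unfolding mat_diag_mult_vec[OF e] using i by simp
  qed
  define E where "E = mat_diag n (\<lambda>i. sqrt (d i))"
  have E: "psd_mat n E" unfolding E_def by (rule psd_mat_diag) (simp add: d)
  note ec = psd_matD[OF E]
  have EE: "E * E = mat_diag n d"
    unfolding E_def mat_diag_diag using d by (auto simp: mat_diag_def intro!: eq_matI)
  define R where "R = Q * E * Q\<^sup>T"
  have Rc: "R \<in> carrier_mat n n" using q(1) ec(1) by (simp add: R_def)
  have "R\<^sup>T = R"
    unfolding R_def using q(1) ec(1,2)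
    by (simp add: transpose_mult[of _ n n _ n] assoc_mult_mat[of _ n n _ n _ n])
  moreover have "0 \<le> x \<bullet> (R *\<^sub>v x)" if x: "x \<in> carrier_vec n" for x
  proof -
    have "x \<bullet> (R *\<^sub>v x) = x \<bullet> (Q *\<^sub>v (E *\<^sub>v (Q\<^sup>T *\<^sub>v x)))"
      unfolding R_def using q(1) ec(1) x
      by (simp add: assoc_mult_mat_vec[of _ n n _ n] del: assoc_mult_mat)
    also have "\<dots> = (Q\<^sup>T *\<^sub>v x) \<bullet> (E *\<^sub>v (Q\<^sup>T *\<^sub>v x))"
      by (rule transpose_vec_mult_scalar[symmetric]) (use q(1) ec(1) x in auto)
    also have "\<dots> \<ge> 0" by (rule ec(3)) (use q(1) x in simp)
    finally show ?thesis .
  qed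
  ultimately have R: "psd_mat n R" using Rc by (simp add: psd_mat_def)
  have "R * R = Q * (E * ((Q\<^sup>T * Q) * (E * Q\<^sup>T)))"
    unfolding R_def using q(1) ec(1) by (simp add: assoc_mult_mat[of _ n n _ n _ n])
  also have "\<dots> = Q * (E * E) * Q\<^sup>T"
    unfolding q(2) using q(1) ec(1) by (simp add: assoc_mult_mat[of _ n n _ n _ n])
  also have "\<dots> = M" unfolding EE Q(2)[symmetric] by (rule orthonormal_conjugate_eq[OF Q(1) m(1)])
  finally have "R * R = M" .
  with R mat_sqrt_eqI show "psd_mat n (mat_sqrt M)" "mat_sqrt M * mat_sqrt M = M" by metis+
qed

section \<open>Full rank\<close>

context vec_space
begin

text \<open>The rank is the size of a maximal independent subset of the set of columns, where
  repetitions count once. At full column rank this forces distinct columns, which is what turns a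
  nonzero kernel vector into a linear dependence of that set.\<close>

lemma rank_le_card_cols:
  assumes "A \<in> carrier_mat n nc"
  shows "rank A \<le> card (set (cols A))"
proof -
  obtain S where S: "maximal S (\<lambda>T. T \<subseteq> set (cols A) \<and> lin_indpt T)"
    using maximal_exists_superset[of "set (cols A)" "\<lambda>T. T \<subseteq> set (cols A) \<and> lin_indpt T" "{}"]
    by (auto simp: finite_lin_indpt2)
  then show ?thesis
    unfolding rank_card_indpt[OF assms S] by (auto simp: maximal_def intro: card_mono)
qed

lemma full_col_rank_injective:
  assumes A: "A \<in> carrier_mat n nc" and r: "rank A = nc"
    and x: "x \<in> carrier_vec nc" "A *\<^sub>v x = 0\<^sub>v n"
  shows "x = 0\<^sub>v nc"
proof (rule ccontr)
  assume "x \<noteq> 0\<^sub>v nc"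
  have "length (cols A) \<le> card (set (cols A))" using rank_le_card_cols[OF A] r A by simp
  then have "distinct (cols A)" by (metis card_distinct card_length le_antisym)
  with lin_depI[OF A x(1) \<open>x \<noteq> 0\<^sub>v nc\<close> x(2)] full_rank_lin_indpt[OF A r] show False by blast
qed

text \<open>A maximal independent set of columns has as many elements as the dimension of the space,
  so it is already a basis.\<close>

lemma full_row_rank_span_cols:
  assumes A: "A \<in> carrier_mat n nc" and r: "rank A = n"
  shows "span (set (cols A)) = carrier_vec n"
proof -
  obtain S where S: "maximal S (\<lambda>T. T \<subseteq> set (cols A) \<and> lin_indpt T)"
    using maximal_exists_superset[of "set (cols A)" "\<lambda>T. T \<subseteq> set (cols A) \<and> lin_indpt T" "{}"]
    by (auto simp: finite_lin_indpt2)
  have cA: "set (cols A) \<subseteq> carrier_vec n" using A cols_dim by blast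
  have S': "S \<subseteq> set (cols A)" "lin_indpt S" using S by (auto simp: maximal_def)
  have "basis S"
    by (rule dim_li_is_basis)
      (use S' cA finite_subset[OF S'(1)] rank_card_indpt[OF A S] r dim_is_n fin_dim in auto)
  then have "carrier_vec n \<subseteq> span S" by (simp add: basis_def)
  also have "\<dots> \<subseteq> span (set (cols A))" by (rule span_is_monotone[OF S'(1)])
  finally show ?thesis using span_closed[OF cA] by blast
qed

end

text \<open>A kernel vector of the transpose is orthogonal to every column, hence to their span,
  which is the whole space, hence to itself.\<close>

lemma full_row_rank_transpose_injective:
  fixes A :: "real mat"
  assumes A: "A \<in> carrier_mat n nc" and r: "vec_space.rank n A = n"
    and x: "x \<in> carrier_vec n" "A\<^sup>T *\<^sub>v x = 0\<^sub>v nc"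
  shows "x = 0\<^sub>v n"
proof -
  interpret vec_space "TYPE(real)" n .
  have cA: "set (cols A) \<subseteq> carrier_vec n" using A cols_dim by blast
  have "x \<bullet> y = 0" if y: "y \<in> set (cols A)" for y
  proof -
    obtain j where j: "j < nc" "y = col A j" using y A by (auto simp: cols_def)
    then have "col A j \<bullet> x = 0" using arg_cong[OF x(2), of "\<lambda>u. u $ j"] A by simp
    then show ?thesis using j A x(1) comm_scalar_prod[of x n "col A j"] by auto
  qed
  then have "x \<in> orthogonal_complement (span (set (cols A)))"
    unfolding in_orthogonal_complement_span[OF cA] using x(1) by (simp add: orthogonal_complement_def)
  then have "x \<bullet> x = 0"
    unfolding full_row_rank_span_cols[OF A r] using x(1) by (simp add: orthogonal_complement_def)
  then show ?thesis using scalar_prod_self_eq_0_iff[OF x(1)] by simp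
qed

section \<open>Column blocks and projections\<close>

lemma orthonormal_mat_isometry:
  assumes Q: "orthonormal_mat n Q" and x: "x \<in> carrier_vec n"
  shows "(Q *\<^sub>v x) \<bullet> (Q *\<^sub>v x) = x \<bullet> x"
  using orthonormal_matD[OF Q] scalar_prod_mult_mat_vec_self[of Q n n x] x by simp

lemma first_cols_carrier:
  assumes "M \<in> carrier_mat n N" "k \<le> N"
  shows "first_cols k M \<in> carrier_mat n k"
  using assms by (auto simp: first_cols_def)

lemma remaining_cols_carrier:
  assumes "M \<in> carrier_mat n N"
  shows "remaining_cols k M \<in> carrier_mat n (N - k)"
  using assms by (auto simp: remaining_cols_def)

lemma row_first_cols_append_remaining_cols:
  assumes M: "M \<in> carrier_mat n N" "k \<le> N" and i: "i < n"
  shows "row M i = row (first_cols k M) i @\<^sub>v row (remaining_cols k M) i"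
proof (rule eq_vecI)
  note fc = first_cols_carrier[OF M] and rc = remaining_cols_carrier[OF M(1), of k]
  show "dim_vec (row M i) = dim_vec (row (first_cols k M) i @\<^sub>v row (remaining_cols k M) i)"
    using fc rc M by simp
  fix j assume "j < dim_vec (row (first_cols k M) i @\<^sub>v row (remaining_cols k M) i)"
  then have j: "j < N" using fc rc M by simp
  show "row M i $ j = (row (first_cols k M) i @\<^sub>v row (remaining_cols k M) i) $ j"
    using fc rc M i j by (auto simp: first_cols_def remaining_cols_def mat_of_cols_index)
qed

lemma mult_mat_vec_append:
  assumes M: "M \<in> carrier_mat n N" "k \<le> N"
    and a: "a \<in> carrier_vec k" and b: "b \<in> carrier_vec (N - k)"
  shows "M *\<^sub>v (a @\<^sub>v b) = first_cols k M *\<^sub>v a + remaining_cols k M *\<^sub>v b"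
proof (rule eq_vecI)
  note fc = first_cols_carrier[OF M] and rc = remaining_cols_carrier[OF M(1), of k]
  show "dim_vec (M *\<^sub>v (a @\<^sub>v b)) = dim_vec (first_cols k M *\<^sub>v a + remaining_cols k M *\<^sub>v b)"
    using M rc by simp
  fix i assume "i < dim_vec (first_cols k M *\<^sub>v a + remaining_cols k M *\<^sub>v b)"
  then have i: "i < n" using rc by simp
  have "row M i \<bullet> (a @\<^sub>v b) = row (first_cols k M) i \<bullet> a + row (remaining_cols k M) i \<bullet> b"
    unfolding row_first_cols_append_remaining_cols[OF M i]
    by (rule scalar_prod_append[of _ k _ "N - k"]) (use fc rc a b i in auto)
  then show "(M *\<^sub>v (a @\<^sub>v b)) $ i = (first_cols k M *\<^sub>v a + remaining_cols k M *\<^sub>v b) $ i"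
    using M fc rc i by simp
qed

lemma transpose_mult_mat_vec_append:
  assumes M: "M \<in> carrier_mat n N" "k \<le> N" and x: "x \<in> carrier_vec n"
  shows "M\<^sup>T *\<^sub>v x = ((first_cols k M)\<^sup>T *\<^sub>v x) @\<^sub>v ((remaining_cols k M)\<^sup>T *\<^sub>v x)"
proof (rule eq_vecI)
  note fc = first_cols_carrier[OF M] and rc = remaining_cols_carrier[OF M(1), of k]
  show "dim_vec (M\<^sup>T *\<^sub>v x) = dim_vec (((first_cols k M)\<^sup>T *\<^sub>v x) @\<^sub>v ((remaining_cols k M)\<^sup>T *\<^sub>v x))"
    using fc rc M by simp
  fix j assume "j < dim_vec (((first_cols k M)\<^sup>T *\<^sub>v x) @\<^sub>v ((remaining_cols k M)\<^sup>T *\<^sub>v x))"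
  then have j: "j < N" using fc rc M by simp
  have "j < k \<Longrightarrow> col (first_cols k M) j = col M j"
    using fc M j by (intro eq_vecI) (auto simp: first_cols_def mat_of_cols_index)
  moreover have "\<not> j < k \<Longrightarrow> col (remaining_cols k M) (j - k) = col M j"
    using M j by (simp add: remaining_cols_def)
  ultimately show "(M\<^sup>T *\<^sub>v x) $ j
      = (((first_cols k M)\<^sup>T *\<^sub>v x) @\<^sub>v ((remaining_cols k M)\<^sup>T *\<^sub>v x)) $ j"
    using fc rc M j by auto
qed

lemma scalar_prod_append_self:
  fixes a b :: "real vec"
  assumes "a \<in> carrier_vec k" "b \<in> carrier_vec l"
  shows "(a @\<^sub>v b) \<bullet> (a @\<^sub>v b) = a \<bullet> a + b \<bullet> b"
  by (rule scalar_prod_append) (use assms in auto)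

lemma orthonormal_split:
  assumes U: "orthonormal_mat n U" and k: "k \<le> n"
    and a: "a \<in> carrier_vec k" and b: "b \<in> carrier_vec (n - k)"
  defines "y \<equiv> first_cols k U *\<^sub>v a + remaining_cols k U *\<^sub>v b"
  shows "y \<bullet> y = a \<bullet> a + b \<bullet> b"
proof -
  have ab: "a @\<^sub>v b \<in> carrier_vec n" using a b k by (metis append_carrier_vec le_add_diff_inverse)
  have "y = U *\<^sub>v (a @\<^sub>v b)"
    unfolding y_def using mult_mat_vec_append[OF orthonormal_matD(1)[OF U] k a b] ..
  then show ?thesis
    using orthonormal_mat_isometry[OF U ab] scalar_prod_append_self[OF a b] by simp
qed

lemma orthonormal_resolution:
  assumes U: "orthonormal_mat n U" and k: "k \<le> n" and x: "x \<in> carrier_vec n"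
  shows "first_cols k U *\<^sub>v ((first_cols k U)\<^sup>T *\<^sub>v x)
    + remaining_cols k U *\<^sub>v ((remaining_cols k U)\<^sup>T *\<^sub>v x) = x"
proof -
  note u = orthonormal_matD[OF U]
  have "U *\<^sub>v (U\<^sup>T *\<^sub>v x) = x"
    using assoc_mult_mat_vec[of U n n "U\<^sup>T" n x] u x by simp
  then show ?thesis
    unfolding transpose_mult_mat_vec_append[OF u(1) k x]
    using mult_mat_vec_append[OF u(1) k, of "(first_cols k U)\<^sup>T *\<^sub>v x" "(remaining_cols k U)\<^sup>T *\<^sub>v x"]
      first_cols_carrier[OF u(1) k] remaining_cols_carrier[OF u(1), of k] x by simp
qed

text \<open>Padding \<open>b\<close> with \<open>k\<close> leading zeros replaces the block by the
  full matrix \<open>V\<close>, which its transpose inverts; the lower part of the result is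
  \<open>b\<close>.\<close>

lemma remaining_cols_left_inverse:
  assumes V: "orthonormal_mat n V" and k: "k \<le> n" and b: "b \<in> carrier_vec (n - k)"
  shows "(remaining_cols k V)\<^sup>T *\<^sub>v (remaining_cols k V *\<^sub>v b) = b"
proof -
  note v = orthonormal_matD[OF V]
  note fc = first_cols_carrier[OF v(1) k] and rc = remaining_cols_carrier[OF v(1), of k]
  let ?ab = "0\<^sub>v k @\<^sub>v b"
  have ab: "?ab \<in> carrier_vec n"
    using b k by (metis append_carrier_vec le_add_diff_inverse zero_carrier_vec)
  have "first_cols k V *\<^sub>v 0\<^sub>v k = 0\<^sub>v n" using fc by (intro eq_vecI) auto
  then have "V *\<^sub>v ?ab = remaining_cols k V *\<^sub>v b"
    using mult_mat_vec_append[OF v(1) k zero_carrier_vec b] rc b by simp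
  moreover have "V\<^sup>T *\<^sub>v (V *\<^sub>v ?ab) = ?ab"
    using assoc_mult_mat_vec[of "V\<^sup>T" n n V n ?ab] v ab by simp
  ultimately have "((first_cols k V)\<^sup>T *\<^sub>v (remaining_cols k V *\<^sub>v b))
      @\<^sub>v ((remaining_cols k V)\<^sup>T *\<^sub>v (remaining_cols k V *\<^sub>v b)) = 0\<^sub>v k @\<^sub>v b"
    using transpose_mult_mat_vec_append[OF v(1) k, of "remaining_cols k V *\<^sub>v b"] rc b by simp
  then show ?thesis
    by (subst (asm) append_vec_eq[of _ k]) (use fc rc b in auto)
qed

section \<open>The complementary projection and its action on the range of the leading
  columns\<close>

lemma orthogonal_complement_proj:
  assumes Z: "Z \<in> carrier_mat n p" and X: "is_pseudo_inverse Z X"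
  defines "P \<equiv> 1\<^sub>m n - Z * X"
  shows "P \<in> carrier_mat n n" "P\<^sup>T = P"
    and "\<And>y. y \<in> carrier_vec p \<Longrightarrow> P *\<^sub>v (Z *\<^sub>v y) = 0\<^sub>v n"
    and "\<And>x. x \<in> carrier_vec n \<Longrightarrow> (P *\<^sub>v x) \<bullet> (P *\<^sub>v x) \<le> x \<bullet> x"
proof -
  note x = is_pseudo_inverseD[OF X Z]
  have ZX: "Z * X \<in> carrier_mat n n" using Z x(1) by simp
  show P: "P \<in> carrier_mat n n" unfolding P_def by (rule minus_carrier_mat[OF ZX])
  show Ps: "P\<^sup>T = P"
    unfolding P_def using transpose_minus[OF one_carrier_mat ZX] x(4) by simp
  have Pv: "P *\<^sub>v u = u - (Z * X) *\<^sub>v u" if "u \<in> carrier_vec n" for u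
    unfolding P_def using minus_mult_distrib_mat_vec[OF one_carrier_mat ZX that] that by simp
  show PZ: "P *\<^sub>v (Z *\<^sub>v y) = 0\<^sub>v n" if y: "y \<in> carrier_vec p" for y
  proof -
    have "(Z * X) *\<^sub>v (Z *\<^sub>v y) = (Z * X * Z) *\<^sub>v y"
      by (rule assoc_mult_mat_vec[symmetric]) (use ZX Z y in auto)
    then show ?thesis using Pv[of "Z *\<^sub>v y"] Z y x(2) by simp
  qed
  show "(P *\<^sub>v u) \<bullet> (P *\<^sub>v u) \<le> u \<bullet> u" if u: "u \<in> carrier_vec n" for u
  proof -
    have Xu: "X *\<^sub>v u \<in> carrier_vec p" using x(1) u by simp
    have ZXu: "(Z * X) *\<^sub>v u = Z *\<^sub>v (X *\<^sub>v u)" using Z x(1) u by simp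
    have Pu: "P *\<^sub>v u \<in> carrier_vec n" and c: "Z *\<^sub>v (X *\<^sub>v u) \<in> carrier_vec n"
      using P Z Xu u by auto
    \<comment> \<open>Idempotence comes from the annihilation of the range of \<open>Z\<close>,
      since \<open>u\<close> and \<open>P u\<close> differ by \<open>Z (X u)\<close>. With symmetry
      it gives the identity below, from which Cauchy-Schwarz and cancellation yield the
      contraction.\<close>
    have "P *\<^sub>v (P *\<^sub>v u) = P *\<^sub>v u"
      using PZ[OF Xu] mult_minus_distrib_mat_vec[OF P u c] Pv[OF u] Pu unfolding ZXu by simp
    then have "(P *\<^sub>v u) \<bullet> (P *\<^sub>v u) = u \<bullet> (P *\<^sub>v u)"
      using scalar_prod_mult_mat_vec_self[OF P u] P u by (simp add: Ps)
    also have "\<dots> \<le> vec_norm2 u * vec_norm2 (P *\<^sub>v u)"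
      by (rule scalar_prod_le_vec_norm2_mult[OF u Pu])
    finally have "vec_norm2 (P *\<^sub>v u) * vec_norm2 (P *\<^sub>v u) \<le> vec_norm2 u * vec_norm2 (P *\<^sub>v u)"
      by (simp add: power2_vec_norm2[symmetric] power2_eq_square)
    then have "vec_norm2 (P *\<^sub>v u) \<le> vec_norm2 u"
      using vec_norm2_ge_0[of "P *\<^sub>v u"] vec_norm2_ge_0[of u] by (cases "vec_norm2 (P *\<^sub>v u) = 0") simp_all
    then show ?thesis by (simp add: vec_norm2_le_iff)
  qed
qed

text \<open>Since \<open>Z W c = U\<^sub>k c + U\<^sub>r T c\<close> is annihilated by \<open>P\<close>, it may be subtracted from \<open>U\<^sub>k x\<close>
  for an arbitrary \<open>c\<close> before the contraction \<open>P\<close> is dropped. The choice \<open>c = x\<close> leaves \<open>T x\<close>, and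
  the minimising \<open>c\<close> leaves \<open>S x\<close>.\<close>

lemma contraction_first_cols_le:
  assumes U: "orthonormal_mat n U" and k: "k \<le> n"
    and Z: "Z \<in> carrier_mat n p" and W: "W \<in> carrier_mat p k"
    and P: "P \<in> carrier_mat n n"
    and PZ: "\<And>y. y \<in> carrier_vec p \<Longrightarrow> P *\<^sub>v (Z *\<^sub>v y) = 0\<^sub>v n"
    and Pc: "\<And>x. x \<in> carrier_vec n \<Longrightarrow> (P *\<^sub>v x) \<bullet> (P *\<^sub>v x) \<le> x \<bullet> x"
    and inv: "(first_cols k U)\<^sup>T * Z * W = 1\<^sub>m k"
    and T: "T = (remaining_cols k U)\<^sup>T * Z * W"
    and x: "x \<in> carrier_vec k" and c: "c \<in> carrier_vec k"
  shows "(P *\<^sub>v (first_cols k U *\<^sub>v x)) \<bullet> (P *\<^sub>v (first_cols k U *\<^sub>v x))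
    \<le> (x - c) \<bullet> (x - c) + (T *\<^sub>v c) \<bullet> (T *\<^sub>v c)"
proof -
  let ?F = "first_cols k U" and ?G = "remaining_cols k U"
  note u = orthonormal_matD[OF U]
  note F = first_cols_carrier[OF u(1) k] and G = remaining_cols_carrier[OF u(1), of k]
  have "T \<in> carrier_mat (n - k) k"
    unfolding T by (rule mult_carrier_mat[OF mult_carrier_mat[of _ _ n _ p]]) (use G Z W in auto)
  then have Tc: "T *\<^sub>v c \<in> carrier_vec (n - k)" using c by (rule mult_mat_vec_carrier)
  define w where "w = Z *\<^sub>v (W *\<^sub>v c)"
  have w: "w \<in> carrier_vec n" and Pw: "P *\<^sub>v w = 0\<^sub>v n" using Z W c PZ by (auto simp: w_def)
  have "?F\<^sup>T *\<^sub>v w = c"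
    using arg_cong[OF inv, of "\<lambda>M. M *\<^sub>v c"] F Z W c
    by (simp add: w_def assoc_mult_mat_vec[of _ k p _ k] assoc_mult_mat_vec[of _ k n _ p] del: assoc_mult_mat)
  moreover have "?G\<^sup>T *\<^sub>v w = T *\<^sub>v c"
    unfolding T w_def using G Z W c
    by (simp add: assoc_mult_mat_vec[of _ "n - k" p _ k] assoc_mult_mat_vec[of _ "n - k" n _ p] del: assoc_mult_mat)
  ultimately have w_eq: "w = ?F *\<^sub>v c + ?G *\<^sub>v (T *\<^sub>v c)"
    using orthonormal_resolution[OF U k w] by simp
  \<comment> \<open>This is \<open>U\<^sub>k x - w\<close> written in coordinates with respect to
    \<open>U\<close>, so that its squared norm splits by Pythagoras.\<close>
  define z where "z = ?F *\<^sub>v (x - c) + ?G *\<^sub>v (-1 \<cdot>\<^sub>v (T *\<^sub>v c))"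
  have z: "z \<in> carrier_vec n" using F G x c Tc by (simp add: z_def)
  have "z = ?F *\<^sub>v x - w"
    unfolding z_def w_eq mult_minus_distrib_mat_vec[OF F x c] mult_mat_vec[OF G Tc]
    by (rule eq_vecI) (use F G x c Tc in auto)
  then have "P *\<^sub>v z = P *\<^sub>v (?F *\<^sub>v x)"
    using mult_minus_distrib_mat_vec[OF P _ w, of "?F *\<^sub>v x"] P F x Pw by simp
  then have "(P *\<^sub>v (?F *\<^sub>v x)) \<bullet> (P *\<^sub>v (?F *\<^sub>v x)) \<le> z \<bullet> z" using Pc[OF z] by simp
  also have "z \<bullet> z = (x - c) \<bullet> (x - c) + (-1 \<cdot>\<^sub>v (T *\<^sub>v c)) \<bullet> (-1 \<cdot>\<^sub>v (T *\<^sub>v c))"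
    unfolding z_def by (rule orthonormal_split[OF U k]) (use x c Tc in auto)
  also have "(-1 \<cdot>\<^sub>v (T *\<^sub>v c)) \<bullet> (-1 \<cdot>\<^sub>v (T *\<^sub>v c)) = (T *\<^sub>v c) \<bullet> (T *\<^sub>v c)"
    by simp
  finally show ?thesis .
qed

text \<open>The second inequality is the quantitative form of positive definiteness; it makes the
  matrix injective, and with it its square root.\<close>

lemma psd_mat_one_plus_mult_transpose:
  fixes T :: "real mat"
  assumes T: "T \<in> carrier_mat r k"
  shows "psd_mat r (1\<^sub>m r + T * T\<^sup>T)"
    and "\<And>x. x \<in> carrier_vec r \<Longrightarrow> x \<bullet> x \<le> x \<bullet> ((1\<^sub>m r + T * T\<^sup>T) *\<^sub>v x)"
proof -
  have TT: "T * T\<^sup>T \<in> carrier_mat r r" using T by simp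
  have "(1\<^sub>m r + T * T\<^sup>T)\<^sup>T = 1\<^sub>m r + T * T\<^sup>T"
    using transpose_add[OF one_carrier_mat TT] transpose_mult[of T r k "T\<^sup>T" r] T by simp
  moreover show le: "x \<bullet> x \<le> x \<bullet> ((1\<^sub>m r + T * T\<^sup>T) *\<^sub>v x)" if x: "x \<in> carrier_vec r" for x
  proof -
    have TTx: "(T * T\<^sup>T) *\<^sub>v x \<in> carrier_vec r" using TT x by (rule mult_mat_vec_carrier)
    have "x \<bullet> ((1\<^sub>m r + T * T\<^sup>T) *\<^sub>v x) = x \<bullet> x + x \<bullet> ((T * T\<^sup>T) *\<^sub>v x)"
      using add_mult_distrib_mat_vec[OF one_carrier_mat TT x] scalar_prod_add_distrib[OF x x TTx] x
      by simp
    also have "x \<bullet> ((T * T\<^sup>T) *\<^sub>v x) = (T\<^sup>T *\<^sub>v x) \<bullet> (T\<^sup>T *\<^sub>v x)"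
      using scalar_prod_mult_mat_vec_self[of "T\<^sup>T" k r x] T x by simp
    finally show ?thesis using scalar_prod_self_ge_0[of "T\<^sup>T *\<^sub>v x"] by linarith
  qed
  ultimately show "psd_mat r (1\<^sub>m r + T * T\<^sup>T)"
    unfolding psd_mat_def using add_carrier_mat[OF TT]
    by (intro conjI ballI order_trans[OF scalar_prod_self_ge_0]) blast+
qed

text \<open>For a scalar tangent \<open>t\<close> and \<open>x = 1\<close>, the least value of
  \<open>(1 - c)\<^sup>2 + t\<^sup>2 c\<^sup>2\<close> is
  \<open>t\<^sup>2 / (1 + t\<^sup>2)\<close>, the squared sine. The matrix \<open>S\<close> is the
  analogue, and the witness is the minimiser.\<close>

lemma normalised_tangent_witness:
  fixes T :: "real mat"
  assumes T: "T \<in> carrier_mat r k"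
    and S: "S = the (mat_inverse (mat_sqrt (1\<^sub>m r + T * T\<^sup>T))) * T"
  shows "S \<in> carrier_mat r k"
    and "\<And>x. x \<in> carrier_vec k \<Longrightarrow>
      \<exists>c \<in> carrier_vec k. (x - c) \<bullet> (x - c) + (T *\<^sub>v c) \<bullet> (T *\<^sub>v c) = (S *\<^sub>v x) \<bullet> (S *\<^sub>v x)"
proof -
  let ?G = "1\<^sub>m r + T * T\<^sup>T" and ?R = "mat_sqrt (1\<^sub>m r + T * T\<^sup>T)"
  have TT: "T * T\<^sup>T \<in> carrier_mat r r" using T by simp
  note G = psd_mat_one_plus_mult_transpose[OF T]
  note R = psd_matD[OF psd_mat_mat_sqrt(1)[OF G(1)]] and RR = psd_mat_mat_sqrt(2)[OF G(1)]
  have inj: "x = 0\<^sub>v r" if x: "x \<in> carrier_vec r" "?R *\<^sub>v x = 0\<^sub>v r" for x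
  proof -
    have "?G *\<^sub>v x = ?R *\<^sub>v (?R *\<^sub>v x)"
      using assoc_mult_mat_vec[OF R(1) R(1) x(1)] RR by simp
    also have "\<dots> = 0\<^sub>v r" unfolding x(2) using R(1) by (intro eq_vecI) auto
    finally have "x \<bullet> x \<le> 0" using G(2)[OF x(1)] x(1) by simp
    then show ?thesis
      using scalar_prod_self_ge_0[of x] scalar_prod_self_eq_0_iff[OF x(1)] by simp
  qed
  obtain B where B: "mat_inverse ?R = Some B" "B \<in> carrier_mat r r" "?R * B = 1\<^sub>m r"
    using inverse_mat_exists[OF R(1) inj] by metis
  have SB: "S = B * T" using S B(1) by simp
  then show Sc: "S \<in> carrier_mat r k" using B T by simp
  fix x :: "real vec" assume x: "x \<in> carrier_vec k"
  have Tx: "T *\<^sub>v x \<in> carrier_vec r" and Sx: "S *\<^sub>v x \<in> carrier_vec r" using T Sc x by auto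
  have RSx: "?R *\<^sub>v (S *\<^sub>v x) = T *\<^sub>v x"
    using assoc_mult_mat_vec[OF R(1) B(2) Tx] assoc_mult_mat_vec[OF B(2) T x] B(3) Tx SB by simp
  define y where "y = B *\<^sub>v (S *\<^sub>v x)"
  have y: "y \<in> carrier_vec r" using B Sx by (simp add: y_def)
  have Ry: "?R *\<^sub>v y = S *\<^sub>v x"
    unfolding y_def using assoc_mult_mat_vec[OF R(1) B(2) Sx] B(3) Sx by simp
  have Gy: "?G *\<^sub>v y = T *\<^sub>v x"
    using assoc_mult_mat_vec[OF R(1) R(1) y] RR Ry RSx by simp
  have Ty: "T\<^sup>T *\<^sub>v y \<in> carrier_vec k" and TTy: "(T * T\<^sup>T) *\<^sub>v y \<in> carrier_vec r"
    using T TT y by auto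
  have Gy': "?G *\<^sub>v y = y + (T * T\<^sup>T) *\<^sub>v y"
    using add_mult_distrib_mat_vec[OF one_carrier_mat TT y] y by simp
  \<comment> \<open>A vanishing gradient means \<open>x - c = T\<^sup>T T c\<close>. With
    \<open>y\<close> in the role of \<open>T c\<close> this is the choice made here, and it is
    consistent because \<open>y\<close> solves \<open>(1 + T T\<^sup>T) y = T x\<close>.\<close>
  define c where "c = x - T\<^sup>T *\<^sub>v y"
  have c: "c \<in> carrier_vec k" using x Ty by (simp add: c_def)
  have xc: "x - c = T\<^sup>T *\<^sub>v y" unfolding c_def using x Ty by (intro eq_vecI) auto
  have "T *\<^sub>v c = T *\<^sub>v x - (T * T\<^sup>T) *\<^sub>v y"
    unfolding c_def using mult_minus_distrib_mat_vec[OF T x Ty] T y by simp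
  also have "\<dots> = y" unfolding Gy[symmetric] Gy' using T y TTy by (intro eq_vecI) (auto simp del: assoc_mult_mat_vec)
  finally have Tc: "T *\<^sub>v c = y" .
  \<comment> \<open>As \<open>S x\<close> is the root applied to \<open>y\<close>, its squared norm
    is the quadratic form at \<open>y\<close>, whose two summands are the squared norms of
    \<open>T c\<close> and \<open>x - c\<close>.\<close>
  have "(S *\<^sub>v x) \<bullet> (S *\<^sub>v x) = y \<bullet> (?G *\<^sub>v y)"
    using scalar_prod_mult_mat_vec_self[OF R(1) y] unfolding Ry R(2) RR .
  also have "\<dots> = y \<bullet> y + y \<bullet> ((T * T\<^sup>T) *\<^sub>v y)"
    unfolding Gy' using scalar_prod_add_distrib[OF y y TTy] .
  also have "y \<bullet> ((T * T\<^sup>T) *\<^sub>v y) = (T\<^sup>T *\<^sub>v y) \<bullet> (T\<^sup>T *\<^sub>v y)"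
    using scalar_prod_mult_mat_vec_self[of "T\<^sup>T" k r y] T y by simp
  finally show "\<exists>c \<in> carrier_vec k. (x - c) \<bullet> (x - c) + (T *\<^sub>v c) \<bullet> (T *\<^sub>v c) = (S *\<^sub>v x) \<bullet> (S *\<^sub>v x)"
    using c xc Tc by (intro bexI[of _ c]) simp_all
qed

section \<open>Singular values\<close>

lemma sing_val_ge_0:
  assumes "is_svd n m A U \<Sigma> V"
  shows "0 \<le> sing_val \<Sigma> i"
  using assms by (cases "i \<in> {1..m}") (auto simp: is_svd_def sing_val_def)

text \<open>The chain continues past the last column, where the values drop to the default 0; this
  covers the index \<open>k + 1\<close> when \<open>k = m\<close>.\<close>

lemma sing_val_antimono:
  assumes svd: "is_svd n m A U \<Sigma> V" and i: "1 \<le> i" and ij: "i \<le> j"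
  shows "sing_val \<Sigma> j \<le> sing_val \<Sigma> i"
  using ij
proof (induction j rule: dec_induct)
  case (step l)
  have "sing_val \<Sigma> (Suc l) \<le> sing_val \<Sigma> l"
  proof (cases "l < m")
    case True
    then show ?thesis using svd i step.hyps by (auto simp: is_svd_def)
  next
    case False
    then have "sing_val \<Sigma> (Suc l) = 0" using svd by (auto simp: is_svd_def sing_val_def)
    then show ?thesis using sing_val_ge_0[OF svd] by simp
  qed
  with step.IH show ?case by simp
qed simp

lemma mat_sqrt_shifted_diag:
  assumes "\<And>i. i < k \<Longrightarrow> s\<^sup>2 \<le> (f i)\<^sup>2"
  shows "mat_sqrt (mat_diag k f * mat_diag k f - s\<^sup>2 \<cdot>\<^sub>m 1\<^sub>m k)
    = mat_diag k (\<lambda>i. sqrt ((f i)\<^sup>2 - s\<^sup>2))"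
proof (rule mat_sqrt_eqI)
  show "psd_mat k (mat_diag k (\<lambda>i. sqrt ((f i)\<^sup>2 - s\<^sup>2)))"
    by (rule psd_mat_diag) (simp add: assms)
  show "mat_diag k (\<lambda>i. sqrt ((f i)\<^sup>2 - s\<^sup>2)) * mat_diag k (\<lambda>i. sqrt ((f i)\<^sup>2 - s\<^sup>2))
      = mat_diag k f * mat_diag k f - s\<^sup>2 \<cdot>\<^sub>m 1\<^sub>m k"
    unfolding mat_diag_diag using assms
    by (auto simp: mat_diag_def power2_eq_square intro!: eq_matI)
qed

lemma diagonal_transpose_mult_vec:
  fixes D :: "real mat"
  assumes D: "D \<in> carrier_mat n m" "diagonal_mat D" "m \<le> n" and q: "q \<in> carrier_vec n"
  shows "D\<^sup>T *\<^sub>v q = vec m (\<lambda>i. D $$ (i, i) * q $ i)"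
proof (rule eq_vecI)
  fix i assume "i < dim_vec (vec m (\<lambda>i. D $$ (i, i) * q $ i))"
  then have i: "i < m" by simp
  have "(D\<^sup>T *\<^sub>v q) $ i = (\<Sum>j\<in>{0..<n}. D $$ (j, i) * q $ j)"
    using D i q by (simp add: scalar_prod_def)
  also have "\<dots> = (\<Sum>j\<in>{0..<n}. if i = j then D $$ (i, i) * q $ i else 0)"
    using D i by (intro sum.cong) (auto simp: diagonal_mat_def)
  finally show "(D\<^sup>T *\<^sub>v q) $ i = vec m (\<lambda>i. D $$ (i, i) * q $ i) $ i" using D i by simp
qed (use D in auto)

text \<open>This is the domination of \<open>\<Sigma> \<Sigma>\<^sup>T\<close> as a quadratic form,
  compared coordinate by coordinate: in the first \<open>k\<close> places the two sides agree, and
  beyond them the singular values are at most \<open>s\<close>.\<close>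

lemma svd_transpose_mult_vec_bound:
  assumes svd: "is_svd n m A U \<Sigma> V" and mn: "m \<le> n" and k: "k \<le> m"
    and q: "a \<in> carrier_vec k" "b \<in> carrier_vec (n - k)"
  defines "s \<equiv> sing_val \<Sigma> (k + 1)"
  defines "h \<equiv> mat_diag k (\<lambda>i. sqrt ((sing_val \<Sigma> (i + 1))\<^sup>2 - s\<^sup>2)) *\<^sub>v a"
  shows "(\<Sigma>\<^sup>T *\<^sub>v (a @\<^sub>v b)) \<bullet> (\<Sigma>\<^sup>T *\<^sub>v (a @\<^sub>v b))
    \<le> s\<^sup>2 * ((a @\<^sub>v b) \<bullet> (a @\<^sub>v b)) + h \<bullet> h"
proof -
  let ?q = "a @\<^sub>v b" and ?\<sigma> = "\<lambda>i. sing_val \<Sigma> (i + 1)"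
  have S: "\<Sigma> \<in> carrier_mat n m" "diagonal_mat \<Sigma>" using svd by (auto simp: is_svd_def)
  have cq: "?q \<in> carrier_vec n"
    using q k mn by (metis append_carrier_vec le_add_diff_inverse le_trans)
  have s0: "0 \<le> s" unfolding s_def by (rule sing_val_ge_0[OF svd])
  have "\<Sigma>\<^sup>T *\<^sub>v ?q = vec m (\<lambda>i. ?\<sigma> i * ?q $ i)"
    unfolding diagonal_transpose_mult_vec[OF S mn cq] using S by (intro eq_vecI) (auto simp: sing_val_def)
  then have "(\<Sigma>\<^sup>T *\<^sub>v ?q) \<bullet> (\<Sigma>\<^sup>T *\<^sub>v ?q) = (\<Sum>i<m. (?\<sigma> i * ?q $ i)\<^sup>2)"
    by (simp add: scalar_prod_self_eq_sum[of _ m])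
  also have "\<dots> \<le> (\<Sum>i<m. s\<^sup>2 * (?q $ i)\<^sup>2 + (if i < k then ((?\<sigma> i)\<^sup>2 - s\<^sup>2) * (a $ i)\<^sup>2 else 0))"
  proof (rule sum_mono)
    fix i assume "i \<in> {..<m}"
    show "(?\<sigma> i * ?q $ i)\<^sup>2 \<le> s\<^sup>2 * (?q $ i)\<^sup>2 + (if i < k then ((?\<sigma> i)\<^sup>2 - s\<^sup>2) * (a $ i)\<^sup>2 else 0)"
    proof (cases "i < k")
      case True
      then have "?q $ i = a $ i" using q by simp
      then show ?thesis using True by (simp add: power_mult_distrib algebra_simps)
    next
      \<comment> \<open>Coordinates count from 0 and singular values from 1, so
        \<open>i \<ge> k\<close> concerns the singular value with number at least
        \<open>k + 1\<close>.\<close>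
      case False
      then have "?\<sigma> i \<le> s" unfolding s_def by (intro sing_val_antimono[OF svd]) auto
      then have "(?\<sigma> i)\<^sup>2 \<le> s\<^sup>2" by (intro power_mono sing_val_ge_0[OF svd])
      then show ?thesis using False by (simp add: power_mult_distrib mult_right_mono)
    qed
  qed
  also have "\<dots> = (\<Sum>i<m. s\<^sup>2 * (?q $ i)\<^sup>2) + (\<Sum>i<k. ((?\<sigma> i)\<^sup>2 - s\<^sup>2) * (a $ i)\<^sup>2)"
  proof -
    have "{..<m} \<inter> {i. i < k} = {..<k}" using k by auto
    then show ?thesis by (simp add: sum.distrib sum.If_cases)
  qed
  \<comment> \<open>The coordinates from \<open>m\<close> to \<open>n\<close>, which
    \<open>\<Sigma>\<^sup>T\<close> discards, are added back to complete the norm.\<close>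
  also have "(\<Sum>i<m. s\<^sup>2 * (?q $ i)\<^sup>2) \<le> (\<Sum>i<n. s\<^sup>2 * (?q $ i)\<^sup>2)"
    using mn by (intro sum_mono2) auto
  also have "\<dots> = s\<^sup>2 * (?q \<bullet> ?q)"
    by (simp add: scalar_prod_self_eq_sum[OF cq] sum_distrib_left)
  also have "(\<Sum>i<k. ((?\<sigma> i)\<^sup>2 - s\<^sup>2) * (a $ i)\<^sup>2) = h \<bullet> h"
  proof -
    have "s\<^sup>2 \<le> (?\<sigma> i)\<^sup>2" if "i < k" for i
      using sing_val_antimono[OF svd, of "i + 1" "k + 1"] that s0 unfolding s_def
      by (intro power_mono) auto
    then show ?thesis
      unfolding h_def mat_diag_mult_vec[OF q(1)]
      by (subst scalar_prod_self_eq_sum[of _ k]) (auto simp: power_mult_distrib)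
  qed
  finally show ?thesis by simp
qed

text \<open>The test vector is column \<open>k + 1\<close> of \<open>V\<close>, which is sent to
  \<open>s\<close> times column \<open>k + 1\<close> of \<open>U\<close>, a unit vector. A lower
  bound suffices, as this norm is subtracted in the final estimate. For \<open>k = m\<close> the
  left side is the default 0.\<close>

lemma sing_val_le_spec_norm_trailing:
  assumes svd: "is_svd n m A U \<Sigma> V" and mn: "m \<le> n" and k: "k \<le> m"
  shows "sing_val \<Sigma> (k + 1)
    \<le> spec_norm (remaining_cols k U * trailing_block k \<Sigma> * (remaining_cols k V)\<^sup>T)"
proof (cases "k < m")
  case False
  then have "sing_val \<Sigma> (k + 1) = 0" using svd by (auto simp: sing_val_def is_svd_def)
  then show ?thesis by simp
next
  case True
  let ?s = "sing_val \<Sigma> (k + 1)" and ?U = "remaining_cols k U" and ?V = "remaining_cols k V"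
    and ?S = "trailing_block k \<Sigma>"
  have U: "orthonormal_mat n U" and V: "orthonormal_mat m V"
    and S: "\<Sigma> \<in> carrier_mat n m" "diagonal_mat \<Sigma>" using svd by (auto simp: is_svd_def)
  note Uc = remaining_cols_carrier[OF orthonormal_matD(1)[OF U], of k]
    and Vc = remaining_cols_carrier[OF orthonormal_matD(1)[OF V], of k]
  have Sc: "?S \<in> carrier_mat (n - k) (m - k)" using S by (auto simp: trailing_block_def)
  have kn: "k \<le> n" using k mn by simp
  let ?e = "unit_vec (m - k) 0 :: real vec" and ?f = "unit_vec (n - k) 0 :: real vec"
  have e: "?e \<in> carrier_vec (m - k)" and f: "?f \<in> carrier_vec (n - k)" by auto
  have norm_rem: "(remaining_cols k Q *\<^sub>v b) \<bullet> (remaining_cols k Q *\<^sub>v b) = b \<bullet> b"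
    if Q: "orthonormal_mat l Q" "k \<le> l" and b: "b \<in> carrier_vec (l - k)" for Q l b
  proof -
    note Qc = remaining_cols_carrier[OF orthonormal_matD(1)[OF Q(1)], of k]
    have Qb: "remaining_cols k Q *\<^sub>v b \<in> carrier_vec l" using Qc b by simp
    have "((remaining_cols k Q)\<^sup>T *\<^sub>v (remaining_cols k Q *\<^sub>v b)) \<bullet> b
        = (remaining_cols k Q *\<^sub>v b) \<bullet> (remaining_cols k Q *\<^sub>v b)"
      by (rule transpose_vec_mult_scalar[OF Qc b Qb])
    then show ?thesis using remaining_cols_left_inverse[OF Q b] by simp
  qed
  have Se: "?S *\<^sub>v ?e = ?s \<cdot>\<^sub>v ?f"
  proof (rule eq_vecI)
    fix i assume "i < dim_vec (?s \<cdot>\<^sub>v ?f)"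
    then have i: "i < n - k" by simp
    have "(?S *\<^sub>v ?e) $ i = ?S $$ (i, 0)" using i Sc True by simp
    also have "\<dots> = \<Sigma> $$ (k + i, k)" using i S True by (simp add: trailing_block_def)
    also have "\<dots> = (?s \<cdot>\<^sub>v ?f) $ i"
      using i S True by (auto simp: sing_val_def diagonal_mat_def)
    finally show "(?S *\<^sub>v ?e) $ i = (?s \<cdot>\<^sub>v ?f) $ i" .
  qed (use Sc in auto)
  define x where "x = ?V *\<^sub>v ?e"
  have x: "x \<in> carrier_vec m" using Vc e by (simp add: x_def)
  have "(?U * ?S * ?V\<^sup>T) *\<^sub>v x = (?U * ?S) *\<^sub>v (?V\<^sup>T *\<^sub>v x)"
    by (rule assoc_mult_mat_vec) (use Uc Vc Sc x in auto)
  also have "\<dots> = (?U * ?S) *\<^sub>v ?e"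
    unfolding x_def remaining_cols_left_inverse[OF V k e] ..
  also have "\<dots> = ?s \<cdot>\<^sub>v (?U *\<^sub>v ?f)"
    using assoc_mult_mat_vec[OF Uc Sc e] Se mult_mat_vec[OF Uc f] by simp
  finally have "vec_norm2 ((?U * ?S * ?V\<^sup>T) *\<^sub>v x) = ?s * vec_norm2 (?U *\<^sub>v ?f)"
    by (simp add: vec_norm2_smult sing_val_ge_0[OF svd])
  moreover have "vec_norm2 (?U *\<^sub>v ?f) = 1"
    unfolding vec_norm2_def norm_rem[OF U kn f] using True mn by simp
  moreover have "vec_norm2 x = 1"
    unfolding vec_norm2_def x_def norm_rem[OF V k e] using True by simp
  moreover have "vec_norm2 ((?U * ?S * ?V\<^sup>T) *\<^sub>v x) \<le> spec_norm (?U * ?S * ?V\<^sup>T) * vec_norm2 x"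
    by (rule vec_norm2_mult_mat_vec_le[OF _ x])
      (rule mult_carrier_mat[OF mult_carrier_mat[OF Uc Sc]], use Vc in simp)
  ultimately show ?thesis by simp
qed

text \<open>Splitting the coordinates of \<open>P z\<close> into \<open>a\<close> and
  \<open>b\<close> bounds the squared norm of \<open>(P A)\<^sup>T z\<close> by a multiple of that
  of \<open>P z\<close> plus the contribution of \<open>H a\<close>. Since the spectral norm is
  invariant under transposition, the latter is controlled by the norm of
  \<open>P U\<^sub>k H\<close>.\<close>

lemma spec_norm_proj_svd_le:
  assumes svd: "is_svd n m A U \<Sigma> V" and mn: "m \<le> n" and k: "k \<le> m"
    and P: "P \<in> carrier_mat n n" "P\<^sup>T = P"
    and Pc: "\<And>x. x \<in> carrier_vec n \<Longrightarrow> (P *\<^sub>v x) \<bullet> (P *\<^sub>v x) \<le> x \<bullet> x"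
  defines "s \<equiv> sing_val \<Sigma> (k + 1)"
  defines "H \<equiv> mat_diag k (\<lambda>i. sqrt ((sing_val \<Sigma> (i + 1))\<^sup>2 - s\<^sup>2))"
  shows "(spec_norm (P * A))\<^sup>2 \<le> s\<^sup>2 + (spec_norm (P * first_cols k U * H))\<^sup>2"
proof -
  let ?F = "first_cols k U" and ?G = "remaining_cols k U" and ?\<beta> = "spec_norm (P * first_cols k U * H)"
  have U: "orthonormal_mat n U" and V: "orthonormal_mat m V"
    and S: "\<Sigma> \<in> carrier_mat n m" and A: "A = U * \<Sigma> * V\<^sup>T" using svd by (auto simp: is_svd_def)
  note u = orthonormal_matD[OF U] and v = orthonormal_matD[OF V]
  have kn: "k \<le> n" using k mn by simp
  note F = first_cols_carrier[OF u(1) kn] and G = remaining_cols_carrier[OF u(1), of k]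
  have H: "H \<in> carrier_mat k k" and Ht: "H\<^sup>T = H" by (simp_all add: H_def mat_diag_transpose)
  have US: "U * \<Sigma> \<in> carrier_mat n m" using u S by simp
  have Ac: "A \<in> carrier_mat n m" unfolding A by (rule mult_carrier_mat[OF US]) (use v in simp)
  have At: "A\<^sup>T = V * (\<Sigma>\<^sup>T * U\<^sup>T)"
    unfolding A using transpose_mult[OF US, of "V\<^sup>T" m] transpose_mult[OF u(1) S] v by simp
  have PA: "P * A \<in> carrier_mat n m" and PF: "P * ?F \<in> carrier_mat n k"
    using P(1) Ac F by auto
  have PFH: "P * ?F * H \<in> carrier_mat n k" by (rule mult_carrier_mat[OF PF H])
  have "spec_norm (P * A)\<^sup>T \<le> sqrt (s\<^sup>2 + ?\<beta>\<^sup>2)"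
  proof (rule spec_norm_leI[of _ m n])
    show "(P * A)\<^sup>T \<in> carrier_mat m n" using PA by simp
    fix z :: "real vec" assume z: "z \<in> carrier_vec n"
    define a where "a = ?F\<^sup>T *\<^sub>v (P *\<^sub>v z)"
    define b where "b = ?G\<^sup>T *\<^sub>v (P *\<^sub>v z)"
    have Pz: "P *\<^sub>v z \<in> carrier_vec n" using P z by simp
    have ab: "a \<in> carrier_vec k" "b \<in> carrier_vec (n - k)" using F G Pz by (auto simp: a_def b_def)
    have q: "U\<^sup>T *\<^sub>v (P *\<^sub>v z) = a @\<^sub>v b"
      unfolding a_def b_def by (rule transpose_mult_mat_vec_append[OF u(1) kn Pz])
    have qc: "a @\<^sub>v b \<in> carrier_vec n" unfolding q[symmetric] using u Pz by simp
    have q_le: "(a @\<^sub>v b) \<bullet> (a @\<^sub>v b) \<le> z \<bullet> z"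
      using orthonormal_mat_isometry[OF orthonormal_mat_transpose[OF U] Pz] Pc[OF z] unfolding q by simp
    have "(P * A)\<^sup>T *\<^sub>v z = A\<^sup>T *\<^sub>v (P *\<^sub>v z)"
      unfolding transpose_mult[OF P(1) Ac] P(2)
      by (rule assoc_mult_mat_vec) (use P Ac z in auto)
    also have "\<dots> = V *\<^sub>v ((\<Sigma>\<^sup>T * U\<^sup>T) *\<^sub>v (P *\<^sub>v z))"
      unfolding At by (rule assoc_mult_mat_vec[of _ m m _ n]) (use v S u Pz in auto)
    also have "(\<Sigma>\<^sup>T * U\<^sup>T) *\<^sub>v (P *\<^sub>v z) = \<Sigma>\<^sup>T *\<^sub>v (a @\<^sub>v b)"
      unfolding q[symmetric] by (rule assoc_mult_mat_vec[of _ m n _ n]) (use S u Pz in auto)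
    finally have "((P * A)\<^sup>T *\<^sub>v z) \<bullet> ((P * A)\<^sup>T *\<^sub>v z) = (\<Sigma>\<^sup>T *\<^sub>v (a @\<^sub>v b)) \<bullet> (\<Sigma>\<^sup>T *\<^sub>v (a @\<^sub>v b))"
      using orthonormal_mat_isometry[OF V, of "\<Sigma>\<^sup>T *\<^sub>v (a @\<^sub>v b)"] S qc by simp
    also have "\<dots> \<le> s\<^sup>2 * ((a @\<^sub>v b) \<bullet> (a @\<^sub>v b)) + (H *\<^sub>v a) \<bullet> (H *\<^sub>v a)"
      unfolding H_def s_def by (rule svd_transpose_mult_vec_bound[OF svd mn k ab])
    \<comment> \<open>Symmetry of both \<open>H\<close> and \<open>P\<close> identifies the weighted
      coordinates with a transposed product acting on \<open>z\<close>.\<close>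
    also have "H *\<^sub>v a = (P * ?F * H)\<^sup>T *\<^sub>v z"
    proof -
      have "(P * ?F * H)\<^sup>T = H * (?F\<^sup>T * P)"
        unfolding transpose_mult[OF PF H] transpose_mult[OF P(1) F] P(2) Ht ..
      then have "(P * ?F * H)\<^sup>T *\<^sub>v z = H *\<^sub>v ((?F\<^sup>T * P) *\<^sub>v z)"
        using assoc_mult_mat_vec[of H k k "?F\<^sup>T * P" n z] H F P z by simp
      also have "(?F\<^sup>T * P) *\<^sub>v z = a"
        unfolding a_def by (rule assoc_mult_mat_vec[of _ k n _ n]) (use F P z in auto)
      finally show ?thesis ..
    qed
    also have "((P * ?F * H)\<^sup>T *\<^sub>v z) \<bullet> ((P * ?F * H)\<^sup>T *\<^sub>v z) \<le> ?\<beta>\<^sup>2 * (z \<bullet> z)"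
    proof -
      have "vec_norm2 ((P * ?F * H)\<^sup>T *\<^sub>v z) \<le> ?\<beta> * vec_norm2 z"
        using vec_norm2_mult_mat_vec_le[of "(P * ?F * H)\<^sup>T" k n z] PFH z
        by (simp add: spec_norm_transpose)
      then have "(vec_norm2 ((P * ?F * H)\<^sup>T *\<^sub>v z))\<^sup>2 \<le> (?\<beta> * vec_norm2 z)\<^sup>2"
        by (intro power_mono) simp_all
      then show ?thesis by (simp add: power_mult_distrib power2_vec_norm2)
    qed
    also have "s\<^sup>2 * ((a @\<^sub>v b) \<bullet> (a @\<^sub>v b)) \<le> s\<^sup>2 * (z \<bullet> z)"
      using q_le by (intro mult_left_mono) auto
    finally have "((P * A)\<^sup>T *\<^sub>v z) \<bullet> ((P * A)\<^sup>T *\<^sub>v z) \<le> (s\<^sup>2 + ?\<beta>\<^sup>2) * (z \<bullet> z)"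
      by (simp add: algebra_simps)
    then show "vec_norm2 ((P * A)\<^sup>T *\<^sub>v z) \<le> sqrt (s\<^sup>2 + ?\<beta>\<^sup>2) * vec_norm2 z"
      unfolding vec_norm2_def by (simp flip: real_sqrt_mult)
  qed simp
  then have "(spec_norm (P * A))\<^sup>2 \<le> (sqrt (s\<^sup>2 + ?\<beta>\<^sup>2))\<^sup>2"
    unfolding spec_norm_transpose by (rule power_mono) simp
  then show ?thesis by simp
qed

theorem theorem3p8:
  fixes n m p k :: nat
    and A Z U \<Sigma> V :: "real mat"
    and U\<^sub>k U\<^sub>r V\<^sub>r \<Sigma>\<^sub>k \<Sigma>\<^sub>r A\<^sub>r \<Omega>\<^sub>k \<Omega>\<^sub>r \<Sigma>hat\<^sub>k T\<^sub>k S\<^sub>k :: "real mat"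
  assumes "A \<in> carrier_mat n m" and "m \<le> n"
    and "is_svd n m A U \<Sigma> V"
    and "Z \<in> carrier_mat n p" and "vec_space.rank n Z = p"
    and "p \<le> vec_space.rank n A"
    and "k \<in> {1..p}"
    and "U\<^sub>k = first_cols k U" and "U\<^sub>r = remaining_cols k U"
    and "V\<^sub>r = remaining_cols k V"
    and "\<Sigma>\<^sub>k = mat_diag k (\<lambda>i. sing_val \<Sigma> (i + 1))" and "\<Sigma>\<^sub>r = trailing_block k \<Sigma>"
    and "A\<^sub>r = U\<^sub>r * \<Sigma>\<^sub>r * V\<^sub>r\<^sup>T"
    and "\<Omega>\<^sub>k = U\<^sub>k\<^sup>T * Z" and "\<Omega>\<^sub>r = U\<^sub>r\<^sup>T * Z"
    and "vec_space.rank k \<Omega>\<^sub>k = k"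
    and "\<Sigma>hat\<^sub>k = mat_sqrt (\<Sigma>\<^sub>k * \<Sigma>\<^sub>k - (sing_val \<Sigma> (k + 1))\<^sup>2 \<cdot>\<^sub>m 1\<^sub>m k)"
    and "T\<^sub>k = \<Omega>\<^sub>r * pseudo_inverse \<Omega>\<^sub>k"
    and "S\<^sub>k = the (mat_inverse (mat_sqrt (1\<^sub>m (n - k) + T\<^sub>k * T\<^sub>k\<^sup>T))) * T\<^sub>k"
  shows "(spec_norm ((1\<^sub>m n - range_proj Z) * A))\<^sup>2 - (spec_norm A\<^sub>r)\<^sup>2
    \<le> min ((spec_norm S\<^sub>k)\<^sup>2 * (spec_norm \<Sigma>hat\<^sub>k)\<^sup>2) ((spec_norm (T\<^sub>k * \<Sigma>hat\<^sub>k))\<^sup>2)"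
proof -
  note A = assms(1) and mn = assms(2) and svd = assms(3) and Z = assms(4)
  interpret vec_space "TYPE(real)" n .
  \<comment> \<open>The chain is \<open>k \<le> p\<close>, then \<open>p\<close> at most the rank of
    \<open>A\<close>, and the rank at most the number of columns.\<close>
  have km: "k \<le> m" using assms(6,7) rank_le_nc[OF A] by simp
  then have kn: "k \<le> n" using mn by simp
  let ?F = "first_cols k U" and ?G = "remaining_cols k U"
  define s where "s = sing_val \<Sigma> (k + 1)"
  define H where "H = mat_diag k (\<lambda>i. sqrt ((sing_val \<Sigma> (i + 1))\<^sup>2 - s\<^sup>2))"
  have U: "orthonormal_mat n U" using svd by (simp add: is_svd_def)
  note F = first_cols_carrier[OF orthonormal_matD(1)[OF U] kn]
    and G = remaining_cols_carrier[OF orthonormal_matD(1)[OF U], of k]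
  have s0: "0 \<le> s" unfolding s_def by (rule sing_val_ge_0[OF svd])
  have hat: "\<Sigma>hat\<^sub>k = H"
    unfolding assms(17) assms(11) H_def s_def
  proof (rule mat_sqrt_shifted_diag)
    fix i assume "i < k"
    then show "(sing_val \<Sigma> (k + 1))\<^sup>2 \<le> (sing_val \<Sigma> (i + 1))\<^sup>2"
      by (intro power_mono sing_val_antimono[OF svd] sing_val_ge_0[OF svd]) auto
  qed
  have H: "H \<in> carrier_mat k k" by (simp add: H_def)
  have "is_pseudo_inverse Z (pseudo_inverse Z)"
    by (rule is_pseudo_inverse_pseudo_inverse_injective[OF Z])
      (rule full_col_rank_injective[OF Z assms(5)])
  note proj = orthogonal_complement_proj[OF Z this, folded range_proj_def]
  let ?P = "1\<^sub>m n - range_proj Z"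
  have \<Omega>_eq: "\<Omega>\<^sub>k = ?F\<^sup>T * Z" by (simp only: assms(8,14))
  then have \<Omega>: "\<Omega>\<^sub>k \<in> carrier_mat k p" using F Z by simp
  let ?W = "pseudo_inverse \<Omega>\<^sub>k"
  note \<Omega>_inj = full_row_rank_transpose_injective[OF \<Omega> assms(16)]
  have "is_pseudo_inverse \<Omega>\<^sub>k ?W"
    by (rule pseudo_inverse_right_inverse(1)[OF \<Omega>]) (rule \<Omega>_inj)
  then have W: "?W \<in> carrier_mat p k" by (rule is_pseudo_inverseD(1)[OF _ \<Omega>])
  have inv: "\<Omega>\<^sub>k * ?W = 1\<^sub>m k"
    by (rule pseudo_inverse_right_inverse(2)[OF \<Omega>]) (rule \<Omega>_inj)
  have inv': "?F\<^sup>T * Z * ?W = 1\<^sub>m k" by (simp only: inv \<Omega>_eq[symmetric])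
  have T: "T\<^sub>k = ?G\<^sup>T * Z * ?W" by (simp only: assms(18,15,9))
  have Tc: "T\<^sub>k \<in> carrier_mat (n - k) k"
    unfolding T by (rule mult_carrier_mat[OF mult_carrier_mat[of _ _ n _ p]]) (use G Z W in auto)
  have core: "(?P *\<^sub>v (?F *\<^sub>v x)) \<bullet> (?P *\<^sub>v (?F *\<^sub>v x)) \<le> (x - c) \<bullet> (x - c) + (T\<^sub>k *\<^sub>v c) \<bullet> (T\<^sub>k *\<^sub>v c)"
    if "x \<in> carrier_vec k" "c \<in> carrier_vec k" for x c
    by (rule contraction_first_cols_le[OF U kn Z W proj(1) _ _ inv' T that]) (rule proj(3,4), assumption)+
  note tangent = normalised_tangent_witness[OF Tc assms(19)]
  let ?\<beta> = "spec_norm (?P * ?F * H)"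
  have PFH: "?P * ?F * H \<in> carrier_mat n k"
    by (rule mult_carrier_mat[OF mult_carrier_mat[OF proj(1) F] H])
  have PFHx: "(?P * ?F * H) *\<^sub>v x = ?P *\<^sub>v (?F *\<^sub>v (H *\<^sub>v x))" and Hx: "H *\<^sub>v x \<in> carrier_vec k"
    if x: "x \<in> carrier_vec k" for x
    using assoc_mult_mat_vec[OF mult_carrier_mat[OF proj(1) F] H x]
      assoc_mult_mat_vec[OF proj(1) F, of "H *\<^sub>v x"] H x by auto
  have \<beta>T: "?\<beta> \<le> spec_norm (T\<^sub>k * H)"
  proof (rule spec_norm_leI[OF PFH])
    fix x :: "real vec" assume x: "x \<in> carrier_vec k"
    have "(H *\<^sub>v x - H *\<^sub>v x) = 0\<^sub>v k" using Hx[OF x] by simp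
    then have "vec_norm2 ((?P * ?F * H) *\<^sub>v x) \<le> vec_norm2 (T\<^sub>k *\<^sub>v (H *\<^sub>v x))"
      unfolding PFHx[OF x] vec_norm2_le_iff using core[OF Hx[OF x] Hx[OF x]] by simp
    also have "T\<^sub>k *\<^sub>v (H *\<^sub>v x) = (T\<^sub>k * H) *\<^sub>v x"
      by (rule assoc_mult_mat_vec[OF Tc H x, symmetric])
    also have "vec_norm2 \<dots> \<le> spec_norm (T\<^sub>k * H) * vec_norm2 x"
      by (rule vec_norm2_mult_mat_vec_le[OF mult_carrier_mat[OF Tc H] x])
    finally show "vec_norm2 ((?P * ?F * H) *\<^sub>v x) \<le> spec_norm (T\<^sub>k * H) * vec_norm2 x" .
  qed simp
  have \<beta>S: "?\<beta> \<le> spec_norm S\<^sub>k * spec_norm H"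
  proof (rule spec_norm_leI[OF PFH])
    fix x :: "real vec" assume x: "x \<in> carrier_vec k"
    let ?y = "H *\<^sub>v x"
    obtain c where c: "c \<in> carrier_vec k"
      "(?y - c) \<bullet> (?y - c) + (T\<^sub>k *\<^sub>v c) \<bullet> (T\<^sub>k *\<^sub>v c) = (S\<^sub>k *\<^sub>v ?y) \<bullet> (S\<^sub>k *\<^sub>v ?y)"
      using tangent(2)[OF Hx[OF x]] by blast
    have "vec_norm2 ((?P * ?F * H) *\<^sub>v x) \<le> vec_norm2 (S\<^sub>k *\<^sub>v ?y)"
      unfolding PFHx[OF x] vec_norm2_le_iff using core[OF Hx[OF x] c(1)] c(2) by simp
    \<comment> \<open>Up to here the bound is by the norm of \<open>S\<^sub>k H x\<close>;
      separating the two factors gives the product of norms in the first term of the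
      minimum.\<close>
    also have "\<dots> \<le> spec_norm S\<^sub>k * vec_norm2 ?y"
      by (rule vec_norm2_mult_mat_vec_le[OF tangent(1) Hx[OF x]])
    also have "\<dots> \<le> spec_norm S\<^sub>k * (spec_norm H * vec_norm2 x)"
      by (rule mult_left_mono[OF vec_norm2_mult_mat_vec_le[OF H x]]) simp
    finally show "vec_norm2 ((?P * ?F * H) *\<^sub>v x) \<le> spec_norm S\<^sub>k * spec_norm H * vec_norm2 x"
      by (simp add: mult.assoc)
  qed simp
  have "(spec_norm (?P * A))\<^sup>2 \<le> s\<^sup>2 + ?\<beta>\<^sup>2"
    unfolding s_def H_def by (rule spec_norm_proj_svd_le[OF svd mn km proj(1,2)]) (rule proj(4))
  moreover have "s\<^sup>2 \<le> (spec_norm A\<^sub>r)\<^sup>2"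
    unfolding assms(9,10,12,13) using sing_val_le_spec_norm_trailing[OF svd mn km] s0
    by (intro power_mono) (auto simp: s_def)
  moreover have "?\<beta>\<^sup>2 \<le> (spec_norm S\<^sub>k)\<^sup>2 * (spec_norm H)\<^sup>2"
    using power_mono[OF \<beta>S, of 2] by (simp add: power_mult_distrib)
  moreover have "?\<beta>\<^sup>2 \<le> (spec_norm (T\<^sub>k * H))\<^sup>2"
    using power_mono[OF \<beta>T, of 2] by simp
  ultimately show ?thesis unfolding hat by (intro min.boundedI) linarith+
qed

end
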